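(* For all $m\in\mathbb{N}_0$, the eigenvalues $\rho_m^c$ of $\mathcal{Q}_c$ satisfy $$\rho_m^{c}\ \geq\ \frac{2\sin(2c)^2}{e^2c}\exp\left(-2\log\left(\frac{7e^2\pi}{2c}\right)m\right)\qquad\text{for all } 0<c\leq\frac{\pi}{4},$$ $$\rho_m^{c}\ \geq\ \pi\exp\left(-\frac{\pi(m+1)}{2c}\right)\qquad\text{for all } c>0.$$
   Context: $\mathbb{N}_0$ is the set of nonnegative integers and $\mathrm{sech}=1/\cosh$. For $c>0$, $\mathcal{Q}_c:L^2(-1,1)\to L^2(-1,1)$ is the finite convolution operator $$\mathcal{Q}_c[h](x)=\int_{-1}^{1}\pi c\ \mathrm{sech}\left(\frac{\pi c}{2}(x-y)\right)h(y)\,dy .$$ It is a trace class, symmetric and positive operator. Its (positive real) eigenvalues, in decreasing order and repeated according to multiplicity, are denoted $(\rho_m^c)_{m\in\mathbb{N}_0}$. *)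

theory Defs
  imports "HOL-Analysis.Analysis" "HOL-Library.Equipollence"
begin

section \<open>The complex vector space \<open>L\<^sup>2(-1, 1)\<close>\<close>

abbreviation L_interval :: "real measure" where
  "L_interval \<equiv> lebesgue_on {-1<..<1}"

definition square_integrable :: "(real \<Rightarrow> complex) \<Rightarrow> bool" where
  "square_integrable f \<longleftrightarrow>
     f \<in> borel_measurable L_interval \<and>
     integrable L_interval (\<lambda>x. (cmod (f x))\<^sup>2)"

definition L2_rel :: "(real \<Rightarrow> complex) \<Rightarrow> (real \<Rightarrow> complex) \<Rightarrow> bool" where
  "L2_rel f g \<longleftrightarrow>
     square_integrable f \<and> square_integrable g \<and> (AE x in L_interval. f x = g x)"

lemma square_integrable_zero: "square_integrable (\<lambda>x. 0)"
  by (simp add: square_integrable_def)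

lemma square_integrable_add:
  assumes "square_integrable f" "square_integrable g"
  shows "square_integrable (\<lambda>x. f x + g x)"
proof -
  have [measurable]: "f \<in> borel_measurable L_interval" "g \<in> borel_measurable L_interval"
    using assms by (auto simp: square_integrable_def)
  have "integrable L_interval (\<lambda>x. 2 * (cmod (f x))\<^sup>2 + 2 * (cmod (g x))\<^sup>2)"
    using assms by (auto simp: square_integrable_def)
  then have "integrable L_interval (\<lambda>x. (cmod (f x + g x))\<^sup>2)"
  proof (rule Bochner_Integration.integrable_bound)
    show "AE x in L_interval.
        norm ((cmod (f x + g x))\<^sup>2) \<le> norm (2 * (cmod (f x))\<^sup>2 + 2 * (cmod (g x))\<^sup>2)"
    proof (rule AE_I2)
      fix x
      have "(cmod (f x + g x))\<^sup>2 \<le> (cmod (f x) + cmod (g x))\<^sup>2"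
        by (intro power_mono norm_triangle_ineq) auto
      also have "\<dots> \<le> 2 * (cmod (f x))\<^sup>2 + 2 * (cmod (g x))\<^sup>2"
        using sum_squares_bound[of "cmod (f x)" "cmod (g x)"] by (simp add: power2_sum)
      finally show "norm ((cmod (f x + g x))\<^sup>2) \<le> norm (2 * (cmod (f x))\<^sup>2 + 2 * (cmod (g x))\<^sup>2)"
        by simp
    qed
  qed measurable
  then show ?thesis
    by (simp add: square_integrable_def)
qed

lemma square_integrable_scale:
  assumes "square_integrable f"
  shows "square_integrable (\<lambda>x. a * f x)"
  using assms by (auto simp: square_integrable_def norm_mult power_mult_distrib)

lemma square_integrable_uminus:
  assumes "square_integrable f"
  shows "square_integrable (\<lambda>x. - f x)"
  using square_integrable_scale[OF assms, of "-1"] by simp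

lemma square_integrable_diff:
  assumes "square_integrable f" "square_integrable g"
  shows "square_integrable (\<lambda>x. f x - g x)"
  using square_integrable_add[OF assms(1) square_integrable_uminus[OF assms(2)]] by simp

quotient_type L2 = "real \<Rightarrow> complex" / partial: L2_rel
proof (rule part_equivpI)
  show "\<exists>f. L2_rel f f"
    using square_integrable_zero by (auto simp: L2_rel_def)
  show "symp L2_rel"
    by (auto simp: symp_def L2_rel_def)
  show "transp L2_rel"
    unfolding transp_def L2_rel_def by (auto elim: eventually_elim2)
qed

instantiation L2 :: ab_group_add
begin

lift_definition zero_L2 :: L2 is "\<lambda>x. 0"
  by (simp add: L2_rel_def square_integrable_zero)

lift_definition plus_L2 :: "L2 \<Rightarrow> L2 \<Rightarrow> L2" is "\<lambda>f g x. f x + g x"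
  unfolding L2_rel_def by (auto intro!: square_integrable_add elim: eventually_elim2)

lift_definition minus_L2 :: "L2 \<Rightarrow> L2 \<Rightarrow> L2" is "\<lambda>f g x. f x - g x"
  unfolding L2_rel_def by (auto intro!: square_integrable_diff elim: eventually_elim2)

lift_definition uminus_L2 :: "L2 \<Rightarrow> L2" is "\<lambda>f x. - f x"
  unfolding L2_rel_def by (auto intro!: square_integrable_uminus elim: eventually_mono)

instance
proof
  fix a b c :: L2
  show "a + b + c = a + (b + c)"
    by transfer
      (auto simp: L2_rel_def add.assoc intro!: square_integrable_add)
  show "a + b = b + a"
    by transfer (auto simp: L2_rel_def add.commute intro!: square_integrable_add)
  show "0 + a = a"
    by transfer (auto simp: L2_rel_def)
  show "- a + a = 0"
    by transfer (auto simp: L2_rel_def square_integrable_zero)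
  show "a - b = a + - b"
    by transfer (auto simp: L2_rel_def intro!: square_integrable_diff)
qed

end

lift_definition scale_L2 :: "complex \<Rightarrow> L2 \<Rightarrow> L2" is "\<lambda>a f x. a * f x"
  unfolding L2_rel_def by (auto intro!: square_integrable_scale elim: eventually_mono)

global_interpretation L2: vector_space scale_L2
proof
  fix a b :: complex and f g :: L2
  show "scale_L2 a (f + g) = scale_L2 a f + scale_L2 a g"
    by transfer
      (auto simp: L2_rel_def algebra_simps intro!: square_integrable_add square_integrable_scale)
  show "scale_L2 (a + b) f = scale_L2 a f + scale_L2 b f"
    by transfer
      (auto simp: L2_rel_def algebra_simps intro!: square_integrable_add square_integrable_scale)
  show "scale_L2 a (scale_L2 b f) = scale_L2 (a * b) f"
    by transfer (auto simp: L2_rel_def mult.assoc intro!: square_integrable_scale)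
  show "scale_L2 1 f = f"
    by transfer (auto simp: L2_rel_def)
qed

section \<open>The finite convolution operator and its eigenvalues\<close>

definition sech :: "real \<Rightarrow> real" where
  "sech x = 1 / cosh x"

lemma continuous_on_sech: "continuous_on A sech"
  unfolding sech_def by (intro continuous_intros) auto

lemma abs_sech_le_1: "\<bar>sech x\<bar> \<le> 1"
  using cosh_real_ge_1[of x] by (simp add: sech_def divide_le_eq)

definition Q_fun :: "real \<Rightarrow> (real \<Rightarrow> complex) \<Rightarrow> real \<Rightarrow> complex" where
  "Q_fun c h x =
     (LINT y|L_interval. complex_of_real (pi * c * sech (pi * c / 2 * (x - y))) * h y)"

lemma finite_measure_L_interval: "finite_measure L_interval"
  by (rule finite_measure_lebesgue_on) simp

lemma integrable_if_square_integrable: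
  assumes "square_integrable h"
  shows "integrable L_interval h"
proof (rule Bochner_Integration.integrable_bound)
  show "integrable L_interval (\<lambda>x. 1 + (cmod (h x))\<^sup>2)"
    using assms finite_measure.integrable_const[OF finite_measure_L_interval, of "1::real"]
    by (auto simp: square_integrable_def)
  show "h \<in> borel_measurable L_interval"
    using assms by (simp add: square_integrable_def)
  show "AE x in L_interval. norm (h x) \<le> norm (1 + (cmod (h x))\<^sup>2)"
  proof (rule AE_I2)
    fix x
    have "2 * cmod (h x) \<le> 1 + (cmod (h x))\<^sup>2"
      using sum_squares_bound[of 1 "cmod (h x)"] by simp
    moreover have "0 \<le> cmod (h x)"
      by simp
    ultimately have "cmod (h x) \<le> 1 + (cmod (h x))\<^sup>2"
      by linarith
    then show "norm (h x) \<le> norm (1 + (cmod (h x))\<^sup>2)"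
      by simp
  qed
qed

lemma square_integrable_Q_fun:
  assumes "square_integrable h"
  shows "square_integrable (Q_fun c h)"
proof -
  interpret finite_measure L_interval
    by (rule finite_measure_L_interval)
  have int: "integrable L_interval h"
    using assms by (rule integrable_if_square_integrable)
  have [measurable]: "h \<in> borel_measurable L_interval"
    using int by auto
  have [measurable]: "sech \<in> borel_measurable borel"
    by (intro borel_measurable_continuous_onI continuous_on_sech)
  have [measurable]: "(\<lambda>x. x) \<in> borel_measurable L_interval"
    by (rule continuous_imp_measurable_on_sets_lebesgue) auto
  have meas: "Q_fun c h \<in> borel_measurable L_interval"
    unfolding Q_fun_def[abs_def] by measurable
  define B where "B = \<bar>pi * c\<bar> * (LINT y|L_interval. cmod (h y))"
  have bound: "cmod (Q_fun c h x) \<le> B" for x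
  proof -
    have le: "cmod (complex_of_real (pi * c * sech (pi * c / 2 * (x - y))) * h y)
        \<le> \<bar>pi * c\<bar> * cmod (h y)" for y
    proof -
      have "\<bar>pi * c\<bar> * \<bar>sech (pi * c / 2 * (x - y))\<bar> * cmod (h y) \<le> \<bar>pi * c\<bar> * 1 * cmod (h y)"
        by (intro mult_right_mono mult_left_mono abs_sech_le_1) auto
      then show ?thesis
        by (simp add: norm_mult abs_mult del: of_real_mult)
    qed
    have "cmod (Q_fun c h x) \<le> (LINT y|L_interval. \<bar>pi * c\<bar> * cmod (h y))"
      unfolding Q_fun_def
    proof (rule Bochner_Integration.integral_norm_bound_integral)
      show *: "integrable L_interval (\<lambda>y. \<bar>pi * c\<bar> * cmod (h y))"
        using int by (intro integrable_mult_right integrable_norm)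
      show "integrable L_interval
          (\<lambda>y. complex_of_real (pi * c * sech (pi * c / 2 * (x - y))) * h y)"
      proof (rule Bochner_Integration.integrable_bound[OF *])
        show "AE y in L_interval.
            norm (complex_of_real (pi * c * sech (pi * c / 2 * (x - y))) * h y)
            \<le> norm (\<bar>pi * c\<bar> * cmod (h y))"
        proof (rule AE_I2)
          fix y
          show "norm (complex_of_real (pi * c * sech (pi * c / 2 * (x - y))) * h y)
              \<le> norm (\<bar>pi * c\<bar> * cmod (h y))"
            using le[of y] by (simp add: abs_mult del: of_real_mult)
        qed
      qed measurable
    qed (rule le)
    then show ?thesis
      by (simp add: B_def)
  qed
  have "integrable L_interval (\<lambda>x. (cmod (Q_fun c h x))\<^sup>2)"
  proof (rule integrable_const_bound[of _ "B\<^sup>2"])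
    show "AE x in L_interval. norm ((cmod (Q_fun c h x))\<^sup>2) \<le> B\<^sup>2"
      using bound by (intro AE_I2) (simp add: power_mono)
    show "(\<lambda>x. (cmod (Q_fun c h x))\<^sup>2) \<in> borel_measurable L_interval"
      using meas by measurable
  qed
  with meas show ?thesis
    by (simp add: square_integrable_def)
qed

lift_definition Q :: "real \<Rightarrow> L2 \<Rightarrow> L2" is Q_fun
proof -
  fix c and f g :: "real \<Rightarrow> complex"
  assume rel: "L2_rel f g"
  have "Q_fun c f x = Q_fun c g x" for x
    unfolding Q_fun_def
  proof (rule integral_cong_AE)
    have [measurable]: "f \<in> borel_measurable L_interval" "g \<in> borel_measurable L_interval"
      using rel by (auto simp: L2_rel_def square_integrable_def)
    have [measurable]: "sech \<in> borel_measurable borel"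
      by (intro borel_measurable_continuous_onI continuous_on_sech)
    have [measurable]: "(\<lambda>x. x) \<in> borel_measurable L_interval"
      by (rule continuous_imp_measurable_on_sets_lebesgue) auto
    show "(\<lambda>y. complex_of_real (pi * c * sech (pi * c / 2 * (x - y))) * f y)
        \<in> borel_measurable L_interval"
      by measurable
    show "(\<lambda>y. complex_of_real (pi * c * sech (pi * c / 2 * (x - y))) * g y)
        \<in> borel_measurable L_interval"
      by measurable
    show "AE y in L_interval.
        complex_of_real (pi * c * sech (pi * c / 2 * (x - y))) * f y =
        complex_of_real (pi * c * sech (pi * c / 2 * (x - y))) * g y"
      using rel unfolding L2_rel_def by (elim conjE eventually_mono) simp
  qed
  then show "L2_rel (Q_fun c f) (Q_fun c g)"
    using rel by (auto simp: L2_rel_def intro: square_integrable_Q_fun)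
qed

definition eigenspace :: "(L2 \<Rightarrow> L2) \<Rightarrow> complex \<Rightarrow> L2 set" where
  "eigenspace T \<mu> = {h. T h = scale_L2 \<mu> h}"

text \<open>
  A decreasing sequence lists the eigenvalues of \<open>T\<close>, repeated according to multiplicity, if every
  complex \<open>\<mu>\<close> occurs in it as many times as the dimension of its eigenspace, which is zero when
  \<open>\<mu>\<close> is not an eigenvalue.  The dimension is expressed as the cardinality of a basis because
  \<^const>\<open>L2.dim\<close> is also zero on infinite-dimensional spaces.
\<close>

definition decreasing_eigenvalues :: "(L2 \<Rightarrow> L2) \<Rightarrow> (nat \<Rightarrow> real) \<Rightarrow> bool" where
  "decreasing_eigenvalues T \<rho> \<longleftrightarrow>
     decseq \<rho> \<and>
     (\<forall>\<mu>. \<exists>B. L2.independent B \<and> L2.span B = eigenspace T \<mu> \<and>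
            {m. complex_of_real (\<rho> m) = \<mu>} \<approx> B)"

end

theory Submission
  imports Defs "HOL-Complex_Analysis.Complex_Analysis" "HOL-Real_Asymp.Real_Asymp"
begin

text \<open>
  Since \<open>sech\<close> is, up to scaling, its own Fourier transform, the quadratic form of \<open>Q c\<close> at \<open>h\<close> is
  the integral of \<open>sech (s / c) \<bar>H s\<bar>\<^sup>2\<close>, where \<open>H\<close> is the Fourier transform of \<open>h\<close>. By the
  min-max principle it suffices to bound its Rayleigh quotient below on one space of dimension
  \<open>m + 1\<close>. Following Landau, take the span of \<open>m + 1\<close> cosine bumps on the consecutive subintervals
  of length \<open>w = 2 / (m + 1)\<close>. There \<open>H\<close> is the Fourier transform of one bump times a trigonometric
  polynomial of degree \<open>m\<close> in \<open>w s\<close>. Over the full period \<open>\<bar>s\<bar> \<le> \<pi> / w\<close>, Parseval's identity gives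
  the second bound; for the first one, only the arc \<open>\<bar>w s\<bar> \<le> 2 c\<close> is used, on which a Remez-type
  inequality controls the coefficients of the polynomial.
\<close>

section \<open>The Fourier transform of the hyperbolic secant\<close>

text \<open>The full period reaches up to \<open>A = pi * (m + 1) / 2\<close>, where the weight
  \<open>sech (A / c)\<close> is exponentially small in \<open>1 / c\<close>; the first bound, for
  small \<open>c\<close>, allows only a power of \<open>c\<close> to be lost with each index.
  Stopping at \<open>A = c * (m + 1)\<close> makes the weight \<open>sech (m + 1)\<close>, which is
  free of \<open>c\<close>. Its substitute, interpolation at \<open>m + 1\<close> equally spaced
  nodes, loses a factor of order \<open>(c / 12) ^ (2 * m)\<close>; the loss stays geometric because
  equal spacing produces a factorial, which offsets the power of \<open>m + 1\<close> hidden in the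
  node distance \<open>4 * c / (m + 1)\<close>. The spectral obstacle is that
  \<open>decreasing_eigenvalues\<close> speaks only of dimensions of eigenspaces and offers neither
  an orthonormal system nor an eigenfunction expansion. The min-max argument therefore produces one
  further eigenvector by compactness and contradicts the count of multiplicities.\<close>

lemma sech_pos: "sech x > 0"
  by (simp add: sech_def)

lemma sech_measurable [measurable]: "sech \<in> borel_measurable borel"
  by (intro borel_measurable_continuous_onI continuous_on_sech)

text \<open>Reverse triangle inequality for \<open>exp z\<close> and \<open>exp (- z)\<close>. It
  serves twice: it forces the zeros of \<open>cosh\<close> onto the imaginary axis, and it makes
  \<open>1 / cosh\<close> small on the vertical sides of the contour.\<close>

lemma sinh_Re_le_norm_cosh: "\<bar>sinh (Re z)\<bar> \<le> cmod (cosh z)"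
proof -
  have "\<bar>exp (Re z) - exp (- Re z)\<bar> \<le> cmod (exp z + exp (- z))"
    using norm_triangle_ineq3[of "exp z" "- exp (- z)"] by simp
  moreover have "\<bar>sinh (Re z)\<bar> = \<bar>exp (Re z) - exp (- Re z)\<bar> / 2"
    by (simp add: sinh_field_def)
  moreover have "cmod (cosh z) = cmod (exp z + exp (- z)) / 2"
    by (simp add: cosh_field_def norm_divide)
  ultimately show ?thesis
    by simp
qed

text \<open>The strip is an open convex neighbourhood of \<open>0 \<le> Im z \<le> pi\<close>. It
  meets just one zero because the neighbouring ones, at heights \<open>- pi / 2\<close> and
  \<open>3 * pi / 2\<close>, lie below \<open>- 1\<close> and above \<open>4\<close>.\<close>

lemma cosh_eq_0_strip:
  assumes "cosh z = 0" "- 1 < Im z" "Im z < 4"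
  shows "z = \<i> * of_real (pi / 2)"
proof -
  have "Re z = 0"
    using sinh_Re_le_norm_cosh[of z] assms by simp
  then have z: "z = \<i> * of_real (Im z)"
    by (simp add: complex_eq_iff)
  then have "cosh (\<i> * of_real (Im z)) = 0"
    using assms by simp
  then have "of_real (cos (Im z)) = (0::complex)"
    by (simp add: cosh_field_def cos_exp_eq flip: cos_of_real)
  then have "cos (Im z) = 0"
    by simp
  then obtain n :: int where n: "Im z = of_int n * pi + pi / 2"
    by (auto simp: cos_zero_iff_int2)
  have "- pi < of_int n * pi" "of_int n * pi < pi"
    using assms n pi_gt3 by linarith+
  then have "- 1 * pi < of_int n * pi" "of_int n * pi < 1 * pi"
    by simp_all
  then have "- 1 < (of_int n :: real)" "(of_int n :: real) < 1"
    by (simp_all only: mult_less_cancel_right_pos pi_gt_zero)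
  then have "n = 0" by linarith
  then show ?thesis
    using z n by simp
qed

lemma integrable_sech: "integrable lborel sech"
proof -
  have "set_integrable lborel (einterval (-\<infinity>) \<infinity>) sech"
  proof (rule interval_integral_FTC_nonneg)
    fix x :: real
    show "((\<lambda>t. 2 * arctan (exp t)) has_real_derivative sech x) (at x)"
      by (auto intro!: derivative_eq_intros simp: sech_def cosh_field_def exp_minus field_simps power2_eq_square)
    show "isCont sech x"
      using continuous_on_sech[of UNIV] by (simp add: continuous_on_eq_continuous_at)
  next
    show "(((\<lambda>t. 2 * arctan (exp t)) \<circ> real_of_ereal) \<longlongrightarrow> 0) (at_right (-\<infinity>))"
      unfolding ereal_tendsto_simps1 by real_asymp
    show "(((\<lambda>t. 2 * arctan (exp t)) \<circ> real_of_ereal) \<longlongrightarrow> pi) (at_left \<infinity>)"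
      unfolding ereal_tendsto_simps1 by real_asymp
  qed (auto simp: sech_pos less_imp_le)
  then show ?thesis
    by (simp add: set_integrable_def einterval_def)
qed

text \<open>Residue theorem on the rectangle with base \<open>{-R..R}\<close> and height
  \<open>pi\<close>. Translation by \<open>\<i> * pi\<close> multiplies the integrand by
  \<open>- exp (- pi * s)\<close>, so the top side is a multiple of the bottom side and the two
  combine to the factor \<open>1 + exp (- pi * s)\<close>. The only pole is
  \<open>\<i> * pi / 2\<close>; the error on the right is the contribution of the two vertical
  sides, each of length \<open>pi\<close>.\<close>

lemma sech_contour_integral:
  fixes s :: real
  assumes R: "R > 1"
  defines "f \<equiv> \<lambda>z. exp (\<i> * of_real s * z) / cosh z"
  shows "cmod ((1 + of_real (exp (- pi * s))) * integral {-R..R} (\<lambda>t. f (of_real t))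
           - of_real (2 * pi * exp (- pi * s / 2))) \<le> 2 * pi * exp (pi * \<bar>s\<bar>) / sinh R"
proof -
  define S where "S = {z. - 1 < Im z} \<inter> {z. Im z < 4}"
  define p where "p = \<i> * of_real (pi / 2)"
  define a where "a = complex_of_real (- R)"
  define b where "b = complex_of_real R"
  define w where "w = \<i> * of_real pi"
  have S: "open S" "convex S"
    unfolding S_def by (intro open_Int convex_Int open_halfspace_Im_gt open_halfspace_Im_lt
      convex_halfspace_Im_gt convex_halfspace_Im_lt)+
  have cosh_nz: "cosh z \<noteq> 0" if "z \<in> S" "z \<noteq> p" for z
    using cosh_eq_0_strip[of z] that by (auto simp: S_def p_def)
  have holo: "f holomorphic_on S - {p}"
    unfolding f_def using cosh_nz by (auto intro!: holomorphic_intros simp: cosh_field_def)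
  have rp: "rectpath a (b + w) =
      linepath a b +++ linepath b (b + w) +++ linepath (b + w) (a + w) +++ linepath (a + w) a"
  proof -
    have "Complex (Re (b + w)) (Im a) = b" "Complex (Re a) (Im (b + w)) = a + w"
      by (simp_all add: a_def b_def w_def complex_eq_iff)
    then show ?thesis
      by (simp add: rectpath_def Let_def)
  qed
  have sub: "path_image (rectpath a (b + w)) \<subseteq> S - {p}"
  proof -
    have "path_image (rectpath a (b + w)) = cbox a (b + w) - box a (b + w)"
      using R by (intro path_image_rectpath_cbox_minus_box) (auto simp: a_def b_def w_def)
    moreover have "p \<in> box a (b + w)"
      using R by (auto simp: in_box_complex_iff a_def b_def w_def p_def)
    moreover have "cbox a (b + w) \<subseteq> S"
      using pi_less_4 by (auto simp: in_cbox_complex_iff a_def b_def w_def S_def)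
    ultimately show ?thesis
      by auto
  qed
  have cont: "continuous_on (path_image (rectpath a (b + w))) f"
    using holo sub holomorphic_on_imp_continuous_on continuous_on_subset by blast
  have img: "path_image (rectpath a (b + w)) = closed_segment a b \<union> closed_segment b (b + w)
      \<union> closed_segment (b + w) (a + w) \<union> closed_segment (a + w) a"
    by (simp add: rp path_image_join Un_assoc)
  have ci: "f contour_integrable_on linepath a b" "f contour_integrable_on linepath b (b + w)"
    "f contour_integrable_on linepath (b + w) (a + w)" "f contour_integrable_on linepath (a + w) a"
    using cont unfolding img by (auto intro!: contour_integrable_continuous_linepath elim: continuous_on_subset)
  have split: "contour_integral (rectpath a (b + w)) f = contour_integral (linepath a b) f
      + contour_integral (linepath b (b + w)) f + contour_integral (linepath (b + w) (a + w)) f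
      + contour_integral (linepath (a + w) a) f"
    unfolding rp using ci by simp
  have res: "residue f p = exp (- pi * s / 2) / \<i>"
  proof -
    have "residue (\<lambda>z. exp (\<i> * of_real s * z) / cosh z) p = exp (\<i> * of_real s * p) / sinh p"
    proof (rule residue_simple_pole_deriv[where s = S])
      show "connected S" using S by (simp add: convex_connected)
      show "p \<in> S"
        using pi_less_4 pi_gt3 unfolding S_def p_def by (simp add: S_def p_def)
      have ep: "exp p = \<i>" "exp (- p) = - \<i>"
        unfolding p_def by (simp_all add: exp_minus exp_eq_polar cis_conv_exp[symmetric])
      show "(cosh has_field_derivative sinh p) (at p)"
        by (auto intro!: derivative_eq_intros)
      show "cosh p = 0" "sinh p \<noteq> 0"
        by (simp_all add: cosh_field_def sinh_field_def ep)
    qed (use S in \<open>auto intro!: holomorphic_intros simp: cosh_field_def[abs_def]\<close>)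
    moreover have "sinh p = \<i>"
      unfolding p_def by (simp add: sinh_field_def exp_minus exp_eq_polar cis_conv_exp[symmetric])
    moreover have "\<i> * of_real s * p = of_real (- pi * s / 2)"
      by (simp add: p_def complex_eq_iff)
    ultimately show ?thesis
      by (simp add: f_def flip: exp_of_real)
  qed
  have full: "contour_integral (rectpath a (b + w)) f = of_real (2 * pi * exp (- pi * s / 2))"
  proof -
    have "contour_integral (rectpath a (b + w)) f =
        2 * pi * \<i> * (\<Sum>q\<in>{p}. winding_number (rectpath a (b + w)) q * residue f q)"
    proof (rule Residue_theorem)
      show "\<forall>z. z \<notin> S \<longrightarrow> winding_number (rectpath a (b + w)) z = 0"
        using pi_less_4 R by (auto intro!: winding_number_rectpath_outside
          simp: in_cbox_complex_iff a_def b_def w_def S_def)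
    qed (use S sub holo in \<open>auto simp: convex_connected\<close>)
    moreover have "winding_number (rectpath a (b + w)) p = 1"
      using R by (intro winding_number_rectpath) (auto simp: in_box_complex_iff a_def b_def w_def p_def)
    ultimately show ?thesis
      by (simp add: res field_simps flip: exp_of_real)
  qed
  have shift: "f (z + w) = - of_real (exp (- pi * s)) * f z" for z
  proof -
    have "cosh (z + w) = - cosh z"
      by (simp add: w_def cosh_field_def exp_add exp_diff exp_minus field_simps)
    moreover have "exp (\<i> * of_real s * (z + w)) = of_real (exp (- pi * s)) * exp (\<i> * of_real s * z)"
    proof -
      have "\<i> * of_real s * (z + w) = of_real (- pi * s) + \<i> * of_real s * z"
        by (simp add: w_def complex_eq_iff algebra_simps)
      then show ?thesis
        by (simp only: exp_add exp_of_real)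
    qed
    ultimately show ?thesis
      by (simp add: f_def)
  qed
  have bot: "contour_integral (linepath a b) f = integral {-R..R} (\<lambda>t. f (of_real t))"
    using R by (subst contour_integral_linepath_Reals_eq) (auto simp: a_def b_def)
  have top: "contour_integral (linepath (b + w) (a + w)) f
      = of_real (exp (- pi * s)) * contour_integral (linepath a b) f"
  proof -
    have "contour_integral (linepath (b + w) (a + w)) f
        = integral {0..1} (\<lambda>x. f (linepath b a x + w) * (a - b))"
      by (simp add: contour_integral_integral linepath_def algebra_simps)
    also have "\<dots> = integral {0..1} (\<lambda>x. - of_real (exp (- pi * s)) * (f (linepath b a x) * (a - b)))"
      by (simp only: shift mult.assoc)
    also have "\<dots> = - of_real (exp (- pi * s)) * contour_integral (linepath b a) f"
      by (simp add: contour_integral_integral)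
    also have "contour_integral (linepath b a) f = - contour_integral (linepath a b) f"
      using cont by (intro contour_integral_reverse_linepath)
        (auto simp: img closed_segment_commute intro: continuous_on_subset)
    finally show ?thesis by simp
  qed
  have bound: "cmod (f z) \<le> exp (pi * \<bar>s\<bar>) / sinh R"
    if "\<bar>Re z\<bar> = R" "0 \<le> Im z" "Im z \<le> pi" for z
  proof -
    have "cmod (exp (\<i> * of_real s * z)) = exp (- s * Im z)"
      by simp
    also have "\<dots> \<le> exp (pi * \<bar>s\<bar>)"
    proof -
      have "- s * Im z \<le> \<bar>s\<bar> * Im z"
        using that by (intro mult_right_mono) auto
      also have "\<dots> \<le> \<bar>s\<bar> * pi"
        using that by (intro mult_left_mono) auto
      finally show ?thesis by (simp add: mult.commute)
    qed
    finally have "cmod (exp (\<i> * of_real s * z)) \<le> exp (pi * \<bar>s\<bar>)" .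
    moreover have "sinh R \<le> cmod (cosh z)"
      using sinh_Re_le_norm_cosh[of z] that R by (cases "Re z \<ge> 0") auto
    moreover have "sinh R > 0" using R by simp
    ultimately show ?thesis
      unfolding f_def norm_divide by (intro frac_le) auto
  qed
  have side1: "cmod (contour_integral (linepath b (b + w)) f) \<le> exp (pi * \<bar>s\<bar>) / sinh R * cmod (b + w - b)"
  proof (rule contour_integral_bound_linepath)
    fix z assume "z \<in> closed_segment b (b + w)"
    then show "cmod (f z) \<le> exp (pi * \<bar>s\<bar>) / sinh R"
      using R by (intro bound) (auto simp: closed_segment_def a_def b_def w_def algebra_simps mult_left_le_one_le)
  qed (use ci R in auto)
  have side2: "cmod (contour_integral (linepath (a + w) a) f) \<le> exp (pi * \<bar>s\<bar>) / sinh R * cmod (a - (a + w))"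
  proof (rule contour_integral_bound_linepath)
    fix z assume "z \<in> closed_segment (a + w) a"
    then show "cmod (f z) \<le> exp (pi * \<bar>s\<bar>) / sinh R"
    proof -
      obtain u where u: "z = (1 - u) *\<^sub>R (a + w) + u *\<^sub>R a" "0 \<le> u" "u \<le> 1"
        using \<open>z \<in> _\<close> by (auto simp: closed_segment_def)
      have "Re z = - R" "Im z = (1 - u) * pi"
        unfolding u(1) by (simp_all add: a_def w_def algebra_simps)
      then show ?thesis
        using R u by (intro bound) (simp_all add: mult_left_le_one_le)
    qed
  qed (use ci R in auto)
  have "(1 + of_real (exp (- pi * s))) * integral {-R..R} (\<lambda>t. f (of_real t))
           - of_real (2 * pi * exp (- pi * s / 2)) =
     - (contour_integral (linepath b (b + w)) f + contour_integral (linepath (a + w) a) f)"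
    using split full by (simp add: bot top algebra_simps)
  also have "cmod \<dots> \<le> exp (pi * \<bar>s\<bar>) / sinh R * pi + exp (pi * \<bar>s\<bar>) / sinh R * pi"
    unfolding norm_minus_cancel
    using side1 side2 by (intro order_trans[OF norm_triangle_ineq] add_mono) (auto simp: w_def norm_mult)
  finally show ?thesis
    by (simp add: field_simps)
qed

text \<open>Limit of the contour identity for \<open>R = n\<close>: the vertical sides vanish, so
  the integral is \<open>P / K\<close>, and multiplying numerator and denominator by
  \<open>exp (pi * s / 2)\<close> turns this quotient into a hyperbolic secant.\<close>

lemma sech_fourier_unscaled:
  fixes s :: real
  shows "(LINT t|lborel. of_real (sech t) * exp (\<i> * of_real (s * t))) = of_real (pi * sech (pi * s / 2))"
proof -
  define f where "f = (\<lambda>z::complex. exp (\<i> * of_real s * z) / cosh z)"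
  define g where "g = (\<lambda>t::real. of_real (sech t) * exp (\<i> * of_real (s * t)))"
  define J where "J = (\<lambda>n::nat. integral {- real n..real n} (\<lambda>t. f (of_real t)))"
  define K :: complex where "K = 1 + of_real (exp (- pi * s))"
  define P :: complex where "P = of_real (2 * pi * exp (- pi * s / 2))"
  have fg: "f (of_real t) = g t" for t
    by (simp add: f_def g_def sech_def cosh_field_def exp_of_real mult.assoc flip: exp_of_real)
  have gcont: "continuous_on A g" for A
    unfolding g_def by (intro continuous_intros continuous_on_sech)
  have gint: "integrable lborel g"
    by (rule Bochner_Integration.integrable_bound[OF integrable_sech])
      (auto simp: g_def norm_mult)
  have "(\<lambda>n. K * J n - P) \<longlonglongrightarrow> 0"
  proof (rule Lim_null_comparison)
    show "\<forall>\<^sub>F n in sequentially. cmod (K * J n - P) \<le> 2 * pi * exp (pi * \<bar>s\<bar>) / sinh (real n)"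
      using eventually_gt_at_top[of 1]
    proof eventually_elim
      case (elim n)
      then show ?case
        using sech_contour_integral[of "real n" s] by (simp add: K_def J_def P_def f_def)
    qed
    show "(\<lambda>n. 2 * pi * exp (pi * \<bar>s\<bar>) / sinh (real n)) \<longlonglongrightarrow> 0"
      by real_asymp
  qed
  then have lim1: "(\<lambda>n. K * J n) \<longlonglongrightarrow> P"
    by (simp add: Lim_null[symmetric])
  have "(\<lambda>n. LINT t|lborel. indicator {- real n..real n} t *\<^sub>R g t) \<longlonglongrightarrow> (LINT t|lborel. g t)"
  proof (rule integral_dominated_convergence)
    show "integrable lborel (\<lambda>t. norm (g t))"
      using gint by (rule integrable_norm)
    show "AE t in lborel. (\<lambda>n. indicator {- real n..real n} t *\<^sub>R g t) \<longlonglongrightarrow> g t"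
    proof (rule AE_I2, rule tendsto_eventually)
      fix t :: real
      show "\<forall>\<^sub>F n in sequentially. indicator {- real n..real n} t *\<^sub>R g t = g t"
        using eventually_ge_at_top[of "nat \<lceil>\<bar>t\<bar>\<rceil>"]
        by eventually_elim (auto simp: indicator_def; linarith)
    qed
  qed (use gint in \<open>auto split: split_indicator\<close>)
  moreover have "(LINT t|lborel. indicator {- real n..real n} t *\<^sub>R g t) = J n" for n
  proof -
    have "set_integrable lborel {- real n..real n} g"
      by (rule borel_integrable_atLeastAtMost') (rule gcont)
    then have "(LINT t:{- real n..real n}|lborel. g t) = integral {- real n..real n} g"
      by (rule set_borel_integral_eq_integral(2))
    then show ?thesis
      by (simp add: J_def fg set_lebesgue_integral_def)
  qed
  ultimately have "J \<longlonglongrightarrow> (LINT t|lborel. g t)"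
    by simp
  then have "(\<lambda>n. K * J n) \<longlonglongrightarrow> K * (LINT t|lborel. g t)"
    by (intro tendsto_intros)
  then have "K * (LINT t|lborel. g t) = P"
    using lim1 LIMSEQ_unique by blast
  moreover have "K * of_real (pi * sech (pi * s / 2)) = P"
  proof -
    define e where "e = exp (pi * s / 2)"
    have e: "e > 0" "exp (- pi * s) = 1 / (e * e)" "exp (- pi * s / 2) = 1 / e" "exp (- (pi * s / 2)) = 1 / e"
      by (simp_all add: e_def exp_minus field_simps flip: exp_add)
    have "(1 + exp (- pi * s)) * (pi * sech (pi * s / 2)) = 2 * pi * exp (- pi * s / 2)"
      unfolding sech_def cosh_field_def e(2,3,4) e_def[symmetric] using e(1)
      by (simp add: field_simps power2_eq_square add_pos_pos less_imp_neq[symmetric])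
    then show ?thesis
      unfolding K_def P_def by (metis of_real_1 of_real_add of_real_mult)
  qed
  moreover have "K \<noteq> 0"
  proof -
    have "Re K > 0" by (simp add: K_def add_pos_pos)
    then show ?thesis by auto
  qed
  ultimately show ?thesis
    unfolding g_def by (metis mult_left_cancel)
qed

text \<open>Substitution \<open>s = c * t\<close>, scaled so that the right-hand side at
  \<open>u = x - y\<close> is exactly the kernel of \<open>Q_fun c\<close>.\<close>

lemma sech_fourier:
  fixes c u :: real
  assumes "c > 0"
  shows "(LINT s|lborel. of_real (sech (s / c)) * exp (\<i> * of_real (s * u)))
    = of_real (pi * c * sech (pi * c / 2 * u))"
proof -
  have "(LINT s|lborel. of_real (sech (s / c)) * exp (\<i> * of_real (s * u))) =
      c *\<^sub>R (LINT t|lborel. of_real (sech t) * exp (\<i> * of_real ((c * u) * t)))"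
    using assms by (subst lborel_integral_real_affine[of c _ 0]) (auto simp: mult_ac)
  then show ?thesis
    unfolding sech_fourier_unscaled by (simp add: scaleR_conv_of_real mult_ac)
qed

lemma integrable_sech_scaled:
  assumes "c > 0"
  shows "integrable lborel (\<lambda>s. sech (s / c))"
  using lborel_integrable_real_affine[OF integrable_sech, of "1 / c" 0] assms by simp

section \<open>Trigonometric polynomials\<close>

text \<open>Only nonnegative frequencies occur, so this is an ordinary polynomial of degree at most
  \<open>m\<close> in \<open>exp (\<i> * \<theta>)\<close>, open to Lagrange interpolation at
  \<open>m + 1\<close> nodes.\<close>

definition trigpoly :: "nat \<Rightarrow> (nat \<Rightarrow> complex) \<Rightarrow> real \<Rightarrow> complex" where
  "trigpoly m a \<theta> = (\<Sum>k\<le>m. a k * exp (\<i> * of_real (real k * \<theta>)))"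

lemma continuous_on_trigpoly [continuous_intros]: "continuous_on A (trigpoly m a)"
  unfolding trigpoly_def[abs_def] by (intro continuous_intros)

lemma trigpoly_poly: "trigpoly m a \<theta> = (\<Sum>k\<le>m. a k * exp (\<i> * of_real \<theta>) ^ k)"
  unfolding trigpoly_def by (simp add: exp_of_nat_mult[symmetric] mult_ac)

lemma character_integral:
  fixes n :: int
  shows "((\<lambda>\<theta>. exp (\<i> * of_real (of_int n * \<theta>))) has_integral (if n = 0 then 2 * of_real pi else 0)) {-pi..pi}"
proof (cases "n = 0")
  case True
  then show ?thesis
    using has_integral_const_real[of "1::complex" "-pi" pi] by (simp add: scaleR_conv_of_real)
next
  case False
  define F where "F \<theta> = exp (\<i> * of_real (of_int n * \<theta>)) / (\<i> * of_int n)" for \<theta> :: real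
  have "((\<lambda>\<theta>. exp (\<i> * of_real (of_int n * \<theta>))) has_integral (F pi - F (-pi))) {-pi..pi}"
  proof (rule fundamental_theorem_of_calculus)
    fix x assume "x \<in> {-pi..pi}"
    show "(F has_vector_derivative exp (\<i> * of_real (of_int n * x))) (at x within {-pi..pi})"
    proof -
      have "((\<lambda>z. exp (\<i> * of_int n * z) / (\<i> * of_int n)) has_field_derivative
          exp (\<i> * of_int n * of_real x)) (at (of_real x))"
        using False by (auto intro!: derivative_eq_intros)
      from has_vector_derivative_real_field[OF this] show ?thesis
        by (simp add: F_def[abs_def] mult.assoc)
    qed
  qed auto
  moreover have "F pi = F (-pi)"
  proof -
    have "exp (\<i> * of_real (of_int n * pi)) = exp (\<i> * of_real (of_int n * (- pi)))"
      by (subst exp_eq) (auto intro!: exI[of _ n] simp: algebra_simps)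
    then show ?thesis
      by (simp add: F_def)
  qed
  ultimately show ?thesis
    using False by simp
qed

lemma trigpoly_parseval:
  "((\<lambda>\<theta>. (cmod (trigpoly m a \<theta>))\<^sup>2) has_integral 2 * pi * (\<Sum>k\<le>m. (cmod (a k))\<^sup>2)) {-pi..pi}"
proof -
  have eq: "of_real ((cmod (trigpoly m a \<theta>))\<^sup>2) =
     (\<Sum>j\<le>m. \<Sum>k\<le>m. a j * cnj (a k) * exp (\<i> * of_real (of_int (int j - int k) * \<theta>)))" for \<theta>
  proof -
    have "of_real ((cmod (trigpoly m a \<theta>))\<^sup>2) = trigpoly m a \<theta> * cnj (trigpoly m a \<theta>)"
      by (simp add: complex_norm_square del: of_real_power)
    also have "\<dots> = (\<Sum>j\<le>m. \<Sum>k\<le>m. a j * cnj (a k) *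
        (exp (\<i> * of_real (real j * \<theta>)) * exp (- (\<i> * of_real (real k * \<theta>)))))"
      unfolding trigpoly_def by (simp add: sum_product exp_cnj mult_ac)
    also have "\<dots> = (\<Sum>j\<le>m. \<Sum>k\<le>m. a j * cnj (a k) * exp (\<i> * of_real (of_int (int j - int k) * \<theta>)))"
    proof (intro sum.cong refl arg_cong2[where f = times])
      fix j k :: nat
      have "\<i> * of_real (of_int (int j - int k) * \<theta>) =
          \<i> * of_real (real j * \<theta>) + - (\<i> * of_real (real k * \<theta>))"
        by (simp add: left_diff_distrib right_diff_distrib)
      then show "exp (\<i> * of_real (real j * \<theta>)) * exp (- (\<i> * of_real (real k * \<theta>))) =
          exp (\<i> * of_real (of_int (int j - int k) * \<theta>))"
        by (simp only: exp_add)
    qed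
    finally show ?thesis .
  qed
  have "((\<lambda>\<theta>. of_real ((cmod (trigpoly m a \<theta>))\<^sup>2)) has_integral
     (\<Sum>j\<le>m. \<Sum>k\<le>m. a j * cnj (a k) * (if int j - int k = 0 then 2 * of_real pi else 0))) {-pi..pi}"
    unfolding eq by (intro has_integral_sum finite_atMost has_integral_mult_right character_integral)
  also have "(\<Sum>j\<le>m. \<Sum>k\<le>m. a j * cnj (a k) * (if int j - int k = 0 then 2 * of_real pi else 0))
      = (\<Sum>j\<le>m. a j * cnj (a j) * (2 * of_real pi))"
    by (intro sum.cong refl) (simp add: if_distrib cong: if_cong)
  also have "\<dots> = of_real (2 * pi * (\<Sum>k\<le>m. (cmod (a k))\<^sup>2))"
    by (simp add: sum_distrib_left complex_norm_square mult_ac del: of_real_power)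
  finally have "((Re \<circ> (\<lambda>\<theta>. of_real ((cmod (trigpoly m a \<theta>))\<^sup>2))) has_integral
      Re (of_real (2 * pi * (\<Sum>k\<le>m. (cmod (a k))\<^sup>2)))) {-pi..pi}"
    by (rule has_integral_linear) (rule bounded_linear_Re)
  then show ?thesis
    by (simp only: o_def Re_complex_of_real)
qed

section \<open>Interpolation at equally spaced points of an arc\<close>

lemma lagrange_interpolation_poly:
  fixes z :: "nat \<Rightarrow> complex" and p :: "complex poly"
  assumes "degree p \<le> m"
    and "\<And>i j. i \<le> m \<Longrightarrow> j \<le> m \<Longrightarrow> i \<noteq> j \<Longrightarrow> z i \<noteq> z j"
  shows "poly p x = (\<Sum>j\<le>m. poly p (z j) * (\<Prod>i\<in>{..m} - {j}. (x - z i) / (z j - z i)))"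
proof -
  define L where "L = (\<Sum>j\<le>m. smult (poly p (z j)) (\<Prod>i\<in>{..m} - {j}. smult (1 / (z j - z i)) [:- z i, 1:]))"
  have L: "poly L x = (\<Sum>j\<le>m. poly p (z j) * (\<Prod>i\<in>{..m} - {j}. (x - z i) / (z j - z i)))" for x
    by (simp add: L_def poly_sum poly_prod flip: diff_divide_distrib)
  have "p = L"
  proof (rule poly_eqI_degree[where A = "z ` {..m}"])
    have "inj_on z {..m}"
      using assms(2) by (meson atMost_iff inj_onI)
    then have card: "card (z ` {..m}) = Suc m"
      by (simp add: card_image)
    then show "card (z ` {..m}) > degree p"
      using assms(1) by simp
    have "degree L \<le> m"
      unfolding L_def
    proof (rule degree_sum_le)
      fix j assume "j \<in> {..m}"
      have "degree (\<Prod>i\<in>{..m} - {j}. smult (1 / (z j - z i)) [:- z i, 1:]) \<le>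
          (\<Sum>i\<in>{..m} - {j}. degree (smult (1 / (z j - z i)) [:- z i, 1:]))"
        by (rule degree_prod_sum_le[unfolded o_def]) auto
      also have "\<dots> \<le> (\<Sum>i\<in>{..m} - {j}. 1)"
        by (intro sum_mono order_trans[OF degree_smult_le]) simp
      also have "\<dots> = m"
        using \<open>j \<in> {..m}\<close> by simp
      finally show "degree (smult (poly p (z j)) (\<Prod>i\<in>{..m} - {j}. smult (1 / (z j - z i)) [:- z i, 1:])) \<le> m"
        by (rule order_trans[OF degree_smult_le])
    qed auto
    then show "card (z ` {..m}) > degree L"
      using card by simp
    fix x assume "x \<in> z ` {..m}"
    then obtain k where k: "k \<le> m" "x = z k" by auto
    have "(\<Prod>i\<in>{..m} - {j}. (x - z i) / (z j - z i)) = (if j = k then 1 else 0)" if "j \<le> m" for j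
    proof (cases "j = k")
      case True
      have "(x - z i) / (z j - z i) = 1" if "i \<in> {..m} - {j}" for i
        using that \<open>j \<le> m\<close> assms(2)[of j i] k True by simp
      then show ?thesis
        using True by (simp add: prod.neutral)
    next
      case False
      then show ?thesis
        using k by (subst prod_zero) auto
    qed
    then have "poly L x = (\<Sum>j\<le>m. poly p (z j) * (if j = k then 1 else 0))"
      unfolding L by (intro sum.cong) auto
    also have "\<dots> = poly p x"
      using k by (simp add: if_distrib cong: if_cong)
    finally show "poly p x = poly L x" by simp
  qed
  then show ?thesis
    unfolding L[symmetric] by (rule arg_cong)
qed

text \<open>From \<open>sin y \<ge> y - y ^ 3 / 6\<close>, where \<open>y ^ 2 \<le> 4\<close> bounds
  the cubic term by \<open>2 * y / 3\<close>.\<close>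

lemma sin_ge_third:
  fixes y :: real
  assumes "0 \<le> y" "y \<le> 2"
  shows "y / 3 \<le> sin y"
proof -
  have "\<bar>sin y - (\<Sum>m<3. sin_coeff m * y ^ m)\<bar> \<le> inverse (fact 3) * \<bar>y\<bar> ^ 3"
    by (rule Maclaurin_sin_bound)
  moreover have "(\<Sum>m<3. sin_coeff m * y ^ m) = y"
    by (simp add: eval_nat_numeral sin_coeff_def)
  moreover have "inverse (fact 3) * \<bar>y\<bar> ^ 3 \<le> 2 * y / 3"
  proof -
    have "y ^ 2 \<le> 2 ^ 2"
      using assms by (intro power_mono) auto
    then have "y * y ^ 2 \<le> y * 4"
      using assms by (intro mult_left_mono) auto
    then show ?thesis
      using assms by (simp add: fact_numeral eval_nat_numeral)
  qed
  ultimately show ?thesis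
    using assms by linarith
qed

text \<open>The chord has length \<open>2 * \<bar>sin ((s - t) / 2)\<bar>\<close>. An angle up to
  \<open>4\<close> has its half in the range of \<open>sin_ge_third\<close>; this is the source of
  the condition \<open>real m * d \<le> 4\<close> on the spread of the nodes.\<close>

lemma norm_exp_i_diff_ge:
  fixes s t :: real
  assumes "\<bar>s - t\<bar> \<le> 4"
  shows "\<bar>s - t\<bar> / 3 \<le> cmod (exp (\<i> * of_real s) - exp (\<i> * of_real t))"
proof -
  have "exp (\<i> * of_real s) - exp (\<i> * of_real t) =
      exp (\<i> * of_real t) * (exp (\<i> * of_real (s - t)) - 1)"
    by (simp add: algebra_simps flip: exp_add)
  then have "cmod (exp (\<i> * of_real s) - exp (\<i> * of_real t)) = 2 * \<bar>sin ((s - t) / 2)\<bar>"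
    by (simp add: norm_mult del: of_real_diff add: dist_exp_i_1)
  also have "\<bar>sin ((s - t) / 2)\<bar> = \<bar>sin (\<bar>s - t\<bar> / 2)\<bar>"
  proof (cases "s \<ge> t")
    case False
    then have "(s - t) / 2 = - (\<bar>s - t\<bar> / 2)"
      by (simp add: field_simps)
    then show ?thesis
      by (simp only: sin_minus abs_minus_cancel)
  qed simp
  finally show ?thesis
    using sin_ge_third[of "\<bar>s - t\<bar> / 2"] assms by auto
qed

text \<open>The factors to the left of \<open>j\<close> give \<open>fact j\<close> and those to its
  right \<open>fact (m - j)\<close>. In the Lagrange weights for equally spaced nodes this creates a
  binomial coefficient over \<open>fact m\<close>.\<close>

lemma prod_abs_diff:
  fixes j m :: nat
  assumes "j \<le> m"
  shows "(\<Prod>i\<in>{..m} - {j}. \<bar>real j - real i\<bar>) = fact j * fact (m - j)"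
proof -
  have "{..m} - {j} = {..<j} \<union> {j<..m}"
    using assms by auto
  then have "(\<Prod>i\<in>{..m} - {j}. \<bar>real j - real i\<bar>) =
      (\<Prod>i\<in>{..<j}. \<bar>real j - real i\<bar>) * (\<Prod>i\<in>{j<..m}. \<bar>real j - real i\<bar>)"
    by (simp add: prod.union_disjoint disjoint_iff)
  also have "(\<Prod>i\<in>{..<j}. \<bar>real j - real i\<bar>) = (\<Prod>i\<in>{1..j}. real i)"
    by (rule prod.reindex_bij_witness[of _ "\<lambda>i. j - i" "\<lambda>i. j - i"]) (auto simp: of_nat_diff)
  also have "(\<Prod>i\<in>{j<..m}. \<bar>real j - real i\<bar>) = (\<Prod>i\<in>{1..m - j}. real i)"
    using assms
    by (intro prod.reindex_bij_witness[of _ "\<lambda>i. i + j" "\<lambda>i. i - j"]) (auto simp: of_nat_diff)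
  finally show ?thesis
    by (simp add: fact_prod)
qed

text \<open>Lagrange interpolation at the nodes \<open>exp (\<i> * (\<alpha> + j * d))\<close>.
  Numerators are at most \<open>2\<close> and denominators at least
  \<open>\<bar>j - i\<bar> * d / 3\<close>, so the \<open>j\<close>-th weight is at most
  \<open>(6 / d) ^ m / fact m\<close> times \<open>m choose j\<close>. Bounding every sample by the
  root of the sum of squares and summing the binomials to \<open>2 ^ m\<close> gives the base
  \<open>12 / d\<close>.\<close>

lemma trigpoly_le_samples:
  fixes d \<alpha> \<theta> :: real
  assumes d: "d > 0" "real m * d \<le> 4"
  shows "(cmod (trigpoly m a \<theta>))\<^sup>2 \<le>
    ((12 / d) ^ m / fact m)\<^sup>2 * (\<Sum>j\<le>m. (cmod (trigpoly m a (\<alpha> + real j * d)))\<^sup>2)"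
proof -
  define z where "z = (\<lambda>j::nat. exp (\<i> * of_real (\<alpha> + real j * d)))"
  define x where "x = exp (\<i> * of_real \<theta>)"
  define p where "p = (\<Sum>k\<le>m. monom (a k) k)"
  define S where "S = (\<Sum>j\<le>m. (cmod (trigpoly m a (\<alpha> + real j * d)))\<^sup>2)"
  have p: "poly p (exp (\<i> * of_real t)) = trigpoly m a t" for t
    by (simp add: p_def poly_sum poly_monom trigpoly_poly)
  have deg: "degree p \<le> m"
    unfolding p_def by (intro degree_sum_le) (auto intro: order_trans[OF degree_monom_le])
  have z_diff: "\<bar>real j - real i\<bar> * (d / 3) \<le> cmod (z j - z i)" if "i \<le> m" "j \<le> m" for i j
  proof -
    have eq: "(\<alpha> + real j * d) - (\<alpha> + real i * d) = (real j - real i) * d"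
      by (simp add: algebra_simps)
    have "\<bar>real j - real i\<bar> * d \<le> real m * d"
      using that d by (intro mult_right_mono) auto
    then have "\<bar>real j - real i\<bar> * d \<le> 4"
      using d by linarith
    then have "\<bar>(real j - real i) * d\<bar> \<le> 4"
      using d by (simp add: abs_mult)
    then show ?thesis
      using norm_exp_i_diff_ge[of "\<alpha> + real j * d" "\<alpha> + real i * d"] d
      unfolding eq z_def by (simp add: abs_mult)
  qed
  have neq: "z i \<noteq> z j" if "i \<le> m" "j \<le> m" "i \<noteq> j" for i j
  proof -
    have "0 < \<bar>real i - real j\<bar> * (d / 3)"
      using that d by simp
    then show ?thesis
      using z_diff[OF that(2,1)] by auto
  qed
  have sample: "cmod (poly p (z j)) \<le> sqrt S" if "j \<le> m" for j
  proof -
    have "(cmod (poly p (z j)))\<^sup>2 \<le> S"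
      unfolding S_def z_def p using that by (intro member_le_sum) auto
    then show ?thesis
      by (rule real_le_rsqrt)
  qed
  have weight: "cmod (\<Prod>i\<in>{..m} - {j}. (x - z i) / (z j - z i)) \<le> (6 / d) ^ m / fact m * real (m choose j)"
    if "j \<le> m" for j
  proof -
    have "cmod (\<Prod>i\<in>{..m} - {j}. (x - z i) / (z j - z i)) =
        (\<Prod>i\<in>{..m} - {j}. cmod (x - z i) / cmod (z j - z i))"
      by (simp add: prod_norm[symmetric] norm_divide)
    also have "\<dots> \<le> (\<Prod>i\<in>{..m} - {j}. 2 / (\<bar>real j - real i\<bar> * (d / 3)))"
    proof (intro prod_mono conjI frac_le)
      fix i assume i: "i \<in> {..m} - {j}"
      show "cmod (x - z i) \<le> 2"
        using norm_triangle_ineq4[of x "z i"] by (simp add: x_def z_def del: of_real_add)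
      show "0 < \<bar>real j - real i\<bar> * (d / 3)"
        using i d by simp
      show "\<bar>real j - real i\<bar> * (d / 3) \<le> cmod (z j - z i)"
        using i that by (intro z_diff) auto
    qed auto
    also have "\<dots> = (\<Prod>i\<in>{..m} - {j}. 6 / d) / (\<Prod>i\<in>{..m} - {j}. \<bar>real j - real i\<bar>)"
      unfolding prod_dividef[symmetric] using d by (intro prod.cong) (auto simp: field_simps)
    also have "\<dots> = (6 / d) ^ m / (fact j * fact (m - j))"
      using that by (simp add: prod_abs_diff)
    also have "\<dots> = (6 / d) ^ m / fact m * real (m choose j)"
      using that by (simp add: binomial_fact)
    finally show ?thesis .
  qed
  have "cmod (trigpoly m a \<theta>) = cmod (\<Sum>j\<le>m. poly p (z j) * (\<Prod>i\<in>{..m} - {j}. (x - z i) / (z j - z i)))"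
    using lagrange_interpolation_poly[of p m z x] deg neq by (simp add: x_def p)
  also have "\<dots> \<le> (\<Sum>j\<le>m. sqrt S * ((6 / d) ^ m / fact m * real (m choose j)))"
    unfolding norm_mult
    by (intro sum_norm_le, unfold norm_mult, intro mult_mono sample weight) (auto simp: S_def sum_nonneg)
  also have "\<dots> = sqrt S * ((6 / d) ^ m / fact m * (\<Sum>j\<le>m. real (m choose j)))"
    by (simp add: sum_distrib_left)
  also have "(\<Sum>j\<le>m. real (m choose j)) = 2 ^ m"
    by (simp add: choose_row_sum flip: of_nat_sum)
  also have "sqrt S * ((6 / d) ^ m / fact m * 2 ^ m) = (12 / d) ^ m / fact m * sqrt S"
  proof -
    have "(12 / d) ^ m = (6 / d) ^ m * 2 ^ m"
      unfolding power_mult_distrib[symmetric] by simp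
    then show ?thesis
      by simp
  qed
  finally have "(cmod (trigpoly m a \<theta>))\<^sup>2 \<le> ((12 / d) ^ m / fact m * sqrt S)\<^sup>2"
    by (intro power_mono) auto
  also have "\<dots> = ((12 / d) ^ m / fact m)\<^sup>2 * S"
    unfolding power_mult_distrib[of _ "sqrt S"] by (simp add: S_def sum_nonneg)
  finally show ?thesis
    by (simp add: S_def)
qed

lemma sum_integral_shifts:
  fixes g :: "real \<Rightarrow> real"
  assumes g: "\<And>A. continuous_on A g" and "d \<ge> 0"
  shows "(\<Sum>j<n. integral {\<alpha>..\<alpha> + d} (\<lambda>t. g (t + real j * d))) = integral {\<alpha>..\<alpha> + real n * d} g"
proof (induction n)
  case (Suc n)
  have "integral {\<alpha>..\<alpha> + d} (\<lambda>t. g (t + real n * d)) = integral {\<alpha> + real n * d..\<alpha> + d + real n * d} g"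
    using integral_shift_real_ivl[of "\<alpha> + real n * d" "real n * d" "\<alpha> + d + real n * d" g] by simp
  moreover have "integral {\<alpha>..\<alpha> + real n * d} g + integral {\<alpha> + real n * d..\<alpha> + d + real n * d} g
      = integral {\<alpha>..\<alpha> + d + real n * d} g"
    using assms by (intro Henstock_Kurzweil_Integration.integral_combine integrable_continuous_real) auto
  ultimately show ?case
    using Suc by (simp add: algebra_simps)
qed simp

text \<open>
  Averaging the sampling inequality over all translates of the nodes turns the sum over the
  nodes into an integral over the arc.
\<close>

lemma trigpoly_remez:
  fixes d \<alpha> :: real
  assumes d: "d > 0" "real m * d \<le> 4"
  shows "d * (fact m * (d / 12) ^ m)\<^sup>2 * (\<Sum>k\<le>m. (cmod (a k))\<^sup>2) \<le>
    integral {\<alpha>..\<alpha> + real (Suc m) * d} (\<lambda>\<theta>. (cmod (trigpoly m a \<theta>))\<^sup>2)"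
proof -
  define g where "g = (\<lambda>\<theta>. (cmod (trigpoly m a \<theta>))\<^sup>2)"
  define C where "C = ((12 / d) ^ m / fact m)\<^sup>2"
  define S where "S = (\<Sum>k\<le>m. (cmod (a k))\<^sup>2)"
  have g: "continuous_on A g" for A
    unfolding g_def by (intro continuous_intros)
  have gs: "continuous_on A (\<lambda>t. g (t + b))" for A b
    by (intro continuous_on_compose2[OF g[of UNIV]] continuous_intros) auto
  \<comment> \<open>The sampling bound does not depend on the point \<open>\<theta>\<close> where
    the polynomial is evaluated. Integrating it over a full period, Parseval's identity turns the
    left side into the coefficients and \<open>2 * pi\<close> cancels.\<close>
  have le: "S \<le> C * (\<Sum>j\<le>m. g (t + real j * d))" for t
  proof -
    have "2 * pi * S = integral {-pi..pi} g"
      using trigpoly_parseval[of m a] by (simp add: g_def S_def integral_unique)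
    also have "\<dots> \<le> integral {-pi..pi} (\<lambda>_. C * (\<Sum>j\<le>m. g (t + real j * d)))"
      using trigpoly_le_samples[OF d, of a]
      by (intro integral_le integrable_continuous_real g continuous_intros) (simp add: g_def C_def)
    also have "\<dots> = 2 * pi * (C * (\<Sum>j\<le>m. g (t + real j * d)))"
      by simp
    finally show ?thesis
      by simp
  qed
  have "d * S = integral {\<alpha>..\<alpha> + d} (\<lambda>_. S)"
    using d by simp
  also have "\<dots> \<le> integral {\<alpha>..\<alpha> + d} (\<lambda>t. C * (\<Sum>j\<le>m. g (t + real j * d)))"
    using le by (intro integral_le integrable_continuous_real continuous_intros gs) auto
  also have "\<dots> = C * (\<Sum>j\<le>m. integral {\<alpha>..\<alpha> + d} (\<lambda>t. g (t + real j * d)))"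
    by (subst integral_mult_right, subst Henstock_Kurzweil_Integration.integral_sum)
      (auto intro!: integrable_continuous_real gs)
  \<comment> \<open>The \<open>m + 1\<close> translates of an interval of length \<open>d\<close>
    tile an arc of length \<open>(m + 1) * d\<close>, whereas the nodes of a single sample spread
    only over \<open>m * d\<close>, the length restricted by \<open>d(2)\<close>.\<close>
  also have "(\<Sum>j\<le>m. integral {\<alpha>..\<alpha> + d} (\<lambda>t. g (t + real j * d))) =
      integral {\<alpha>..\<alpha> + real (Suc m) * d} g"
    using sum_integral_shifts[OF g, where d = d and n = "Suc m" and \<alpha> = \<alpha>] d by (simp add: lessThan_Suc_atMost)
  finally have "d * S \<le> C * integral {\<alpha>..\<alpha> + real (Suc m) * d} g" .
  moreover have "C * (fact m * (d / 12) ^ m)\<^sup>2 = 1"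
  proof -
    have "(12 / d) ^ m * (d / 12) ^ m = 1"
      unfolding power_mult_distrib[symmetric] using d by simp
    then have "(12 / d) ^ m / fact m * (fact m * (d / 12) ^ m) = 1"
      by simp
    then show ?thesis
      unfolding C_def power_mult_distrib[symmetric] by simp
  qed
  ultimately have "d * S * (fact m * (d / 12) ^ m)\<^sup>2 \<le>
     C * integral {\<alpha>..\<alpha> + real (Suc m) * d} g * (fact m * (d / 12) ^ m)\<^sup>2"
    by (intro mult_right_mono) auto
  also have "\<dots> = integral {\<alpha>..\<alpha> + real (Suc m) * d} g"
    using \<open>C * _ = 1\<close> by (simp add: mult_ac)
  finally show ?thesis
    by (simp add: g_def S_def mult_ac)
qed

section \<open>Compact symmetric operators\<close>

text \<open>
  A maximising sequence \<open>X\<close> for the Rayleigh quotient on \<open>W\<close> satisfies \<open>T X\<^sub>n - \<mu> X\<^sub>n \<longlongrightarrow> 0\<close>, where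
  \<open>\<mu>\<close> is the supremum, so compactness makes a subsequence of it converge to an eigenvector.
\<close>

lemma compact_symmetric_has_eigenvector:
  fixes T :: "'a :: real_inner \<Rightarrow> 'a"
  assumes lin: "linear T"
    and sym: "\<And>x y. inner (T x) y = inner x (T y)"
    and psd: "\<And>x. inner (T x) x \<ge> 0"
    and bounded: "\<And>x. norm (T x) \<le> K * norm x"
    and compact: "\<And>X. (\<And>n. norm (X n) \<le> 1) \<Longrightarrow> \<exists>r l. strict_mono (r :: nat \<Rightarrow> nat) \<and> (\<lambda>n. T (X (r n))) \<longlonglongrightarrow> l"
    and W: "subspace W" "closed W" "\<And>x. x \<in> W \<Longrightarrow> T x \<in> W"
    and h: "h \<in> W" "h \<noteq> 0" "inner (T h) h \<ge> t * (norm h)\<^sup>2" "t > 0"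
  shows "\<exists>g\<in>W. g \<noteq> 0 \<and> (\<exists>\<mu>\<ge>t. T g = \<mu> *\<^sub>R g)"
proof -
  define A where "A = (\<lambda>x. inner (T x) x) ` {x \<in> W. norm x = 1}"
  define \<mu> where "\<mu> = Sup A"
  have T_scale: "T (a *\<^sub>R x) = a *\<^sub>R T x" and T_diff: "T (x - y) = T x - T y" for a x y
    using lin by (simp_all add: linear_scale linear_diff)
  have "inner (T x) x \<le> K" if "norm x = 1" for x
    using Cauchy_Schwarz_ineq2[of "T x" x] bounded[of x] that by simp
  then have bdd: "bdd_above A"
    by (auto simp: A_def bdd_above_def)
  have "(1 / norm h) *\<^sub>R h \<in> {x \<in> W. norm x = 1}"
    using h W(1) by (simp add: subspace_scale)
  moreover have "inner (T ((1 / norm h) *\<^sub>R h)) ((1 / norm h) *\<^sub>R h) = inner (T h) h / (norm h)\<^sup>2"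
    by (simp add: T_scale power2_eq_square)
  ultimately have hA: "inner (T h) h / (norm h)\<^sup>2 \<in> A"
    unfolding A_def by (metis (no_types, lifting) image_eqI)
  have "t \<le> inner (T h) h / (norm h)\<^sup>2"
    using h by (simp add: pos_le_divide_eq)
  also have "\<dots> \<le> \<mu>"
    unfolding \<mu>_def using hA bdd by (rule cSup_upper)
  finally have "t \<le> \<mu>" .
  with h have "\<mu> > 0"
    by simp
  have le_\<mu>: "inner (T x) x \<le> \<mu> * (norm x)\<^sup>2" if "x \<in> W" for x
  proof (cases "x = 0")
    case False
    have "(1 / norm x) *\<^sub>R x \<in> {x \<in> W. norm x = 1}"
      using False that W(1) by (simp add: subspace_scale)
    then have "inner (T ((1 / norm x) *\<^sub>R x)) ((1 / norm x) *\<^sub>R x) \<in> A"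
      unfolding A_def by blast
    then have "inner (T ((1 / norm x) *\<^sub>R x)) ((1 / norm x) *\<^sub>R x) \<le> \<mu>"
      unfolding \<mu>_def using bdd by (rule cSup_upper)
    then show ?thesis
      using False by (simp add: T_scale power2_eq_square field_simps)
  qed (use linear_0[OF lin] in auto)
  \<comment> \<open>Expands the nonnegative form at \<open>x - (1 / \<mu>) *\<^sub>R T x\<close>.
    The quadratic term is controlled by \<open>le_\<mu>\<close> at \<open>T x\<close>, which lies in
    \<open>W\<close> by invariance.\<close>
  have norm_T: "(norm (T x))\<^sup>2 \<le> \<mu> * inner (T x) x" if "x \<in> W" for x
  proof -
    have "0 \<le> inner (T (x - (1 / \<mu>) *\<^sub>R T x)) (x - (1 / \<mu>) *\<^sub>R T x)"
      by (rule psd)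
    also have "\<dots> = inner (T x) x - 2 / \<mu> * (norm (T x))\<^sup>2 + (1 / \<mu>)\<^sup>2 * inner (T (T x)) (T x)"
      by (simp add: T_diff T_scale inner_diff_left inner_diff_right sym[of "T x" x] power2_norm_eq_inner
        power2_eq_square[of "1 / \<mu>"] diff_divide_distrib)
    also have "(1 / \<mu>)\<^sup>2 * inner (T (T x)) (T x) \<le> (1 / \<mu>)\<^sup>2 * (\<mu> * (norm (T x))\<^sup>2)"
      using that W(3) by (intro mult_left_mono le_\<mu>) auto
    also have "\<dots> = (1 / \<mu>) * (norm (T x))\<^sup>2"
      using \<open>\<mu> > 0\<close> by (simp add: power2_eq_square)
    finally have "(1 / \<mu>) * (norm (T x))\<^sup>2 \<le> inner (T x) x"
      by simp
    then show ?thesis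
      using \<open>\<mu> > 0\<close> by (simp add: field_simps)
  qed
  have "\<exists>x\<in>W. norm x = 1 \<and> \<mu> - inverse (real (Suc n)) < inner (T x) x" for n
  proof -
    have "\<exists>y\<in>A. \<mu> - inverse (real (Suc n)) < y"
      using hA bdd unfolding \<mu>_def by (intro less_cSupD) auto
    then show ?thesis
      by (auto simp: A_def)
  qed
  then obtain X where X: "\<And>n. X n \<in> W" "\<And>n. norm (X n) = 1"
    "\<And>n. \<mu> - inverse (real (Suc n)) < inner (T (X n)) (X n)"
    by metis
  obtain r l where r: "strict_mono (r :: nat \<Rightarrow> nat)" and l: "(\<lambda>n. T (X (r n))) \<longlonglongrightarrow> l"
    using compact[of X] X(2) by auto
  \<comment> \<open>The square expands to \<open>(norm (T (X n)))\<^sup>2 - 2 * \<mu> * inner (T (X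
    n)) (X n) + \<mu>\<^sup>2\<close>; by \<open>norm_T\<close> this is at most \<open>\<mu>\<close>
    times the defect of \<open>X n\<close> from the supremum.\<close>
  have resid: "(norm (T (X n) - \<mu> *\<^sub>R X n))\<^sup>2 \<le> \<mu> * inverse (real (Suc n))" for n
  proof -
    have "(norm (T (X n) - \<mu> *\<^sub>R X n))\<^sup>2 = (norm (T (X n)))\<^sup>2 - 2 * \<mu> * inner (T (X n)) (X n) + \<mu>\<^sup>2"
    proof -
      have "(norm (T (X n) - \<mu> *\<^sub>R X n))\<^sup>2 =
          inner (T (X n)) (T (X n)) - \<mu> * inner (T (X n)) (X n) - \<mu> * inner (X n) (T (X n))
          + \<mu> * \<mu> * inner (X n) (X n)"
        unfolding power2_norm_eq_inner inner_diff_left inner_diff_right inner_scaleR_left inner_scaleR_right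
        by (simp only: algebra_simps)
      moreover have "inner (X n) (T (X n)) = inner (T (X n)) (X n)"
        by (rule inner_commute)
      moreover have "inner (X n) (X n) = 1"
        using X(2)[of n] by (simp add: norm_eq_1)
      ultimately show ?thesis
        by (simp add: power2_norm_eq_inner power2_eq_square[of \<mu>])
    qed
    also have "\<dots> \<le> \<mu> * (\<mu> - inner (T (X n)) (X n))"
      using norm_T[OF X(1)[of n]] by (simp add: algebra_simps power2_eq_square)
    also have "\<dots> \<le> \<mu> * inverse (real (Suc n))"
      using \<open>\<mu> > 0\<close> X(3)[of n] by (intro mult_left_mono) auto
    finally show ?thesis .
  qed
  have "(\<lambda>n. (norm (T (X n) - \<mu> *\<^sub>R X n))\<^sup>2) \<longlonglongrightarrow> 0"
  proof (rule Lim_null_comparison)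
    show "\<forall>\<^sub>F n in sequentially. norm ((norm (T (X n) - \<mu> *\<^sub>R X n))\<^sup>2) \<le> \<mu> * inverse (real (Suc n))"
      by (intro always_eventually allI) (simp only: real_norm_def abs_power2 resid)
    show "(\<lambda>n. \<mu> * inverse (real (Suc n))) \<longlonglongrightarrow> 0"
      by (rule tendsto_mult_right_zero) (rule LIMSEQ_inverse_real_of_nat)
  qed
  then have "(\<lambda>n. sqrt ((norm (T (X n) - \<mu> *\<^sub>R X n))\<^sup>2)) \<longlonglongrightarrow> sqrt 0"
    by (rule tendsto_real_sqrt)
  then have "(\<lambda>n. T (X n) - \<mu> *\<^sub>R X n) \<longlonglongrightarrow> 0"
    by (simp add: tendsto_norm_zero_iff)
  then have "(\<lambda>n. T (X (r n)) - \<mu> *\<^sub>R X (r n)) \<longlonglongrightarrow> 0"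
    using r by (rule LIMSEQ_subseq_LIMSEQ[unfolded o_def])
  \<comment> \<open>Both \<open>T (X (r n))\<close> and the residual converge, hence so does their
    difference; division by \<open>\<mu> > 0\<close> makes the unit vectors \<open>X (r n)\<close>
    themselves converge, so the limit is a unit vector.\<close>
  from tendsto_diff[OF l this] have "(\<lambda>n. \<mu> *\<^sub>R X (r n)) \<longlonglongrightarrow> l"
    by simp
  then have "(\<lambda>n. (1 / \<mu>) *\<^sub>R (\<mu> *\<^sub>R X (r n))) \<longlonglongrightarrow> (1 / \<mu>) *\<^sub>R l"
    by (intro tendsto_intros)
  moreover have "(1 / \<mu>) *\<^sub>R (\<mu> *\<^sub>R x) = x" for x :: 'a
    using \<open>\<mu> > 0\<close> by simp
  ultimately have g: "(\<lambda>n. X (r n)) \<longlonglongrightarrow> (1 / \<mu>) *\<^sub>R l"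
    by (simp only:)
  define g where "g = (1 / \<mu>) *\<^sub>R l"
  have "bounded_linear T"
  proof (rule bounded_linear_intro)
    show "norm (T x) \<le> norm x * K" for x
      using bounded[of x] by (simp only: mult.commute)
  qed (simp_all add: linear_add[OF lin] T_scale)
  then have "(\<lambda>n. T (X (r n))) \<longlonglongrightarrow> T g"
    using g unfolding g_def by (rule bounded_linear.tendsto)
  then have "T g = l"
    using l LIMSEQ_unique by blast
  then have "T g = \<mu> *\<^sub>R g"
    using \<open>\<mu> > 0\<close> by (simp add: g_def)
  moreover have "g \<in> W"
    using closed_sequentially[OF W(2) _ g] X(1) unfolding g_def by blast
  moreover have "norm g = 1"
    using tendsto_norm[OF g] unfolding g_def X(2) LIMSEQ_const_iff by metis
  ultimately show ?thesis
    using \<open>t \<le> \<mu>\<close> by (metis norm_zero zero_neq_one)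
qed

text \<open>Gaussian elimination, one equation per induction step. It is used to make a combination
  of \<open>m + 1\<close> trial functions orthogonal to \<open>m\<close> eigenfunctions.\<close>

lemma homogeneous_system_nontrivial:
  fixes M :: "'j \<Rightarrow> 'i \<Rightarrow> 'a :: field"
  assumes "finite J" "finite I" "card J < card I"
  shows "\<exists>a. (\<exists>i\<in>I. a i \<noteq> 0) \<and> (\<forall>j\<in>J. (\<Sum>i\<in>I. a i * M j i) = 0)"
  using assms
proof (induction J arbitrary: I M rule: finite_induct)
  case empty
  then have "I \<noteq> {}" by auto
  then show ?case
    by (intro exI[of _ "\<lambda>_. 1"]) auto
next
  case (insert j0 J)
  show ?case
  proof (cases "\<forall>i\<in>I. M j0 i = 0")
    case True
    have "card J < card I"
      using insert by simp
    then obtain a where "\<exists>i\<in>I. a i \<noteq> 0" "\<forall>j\<in>J. (\<Sum>i\<in>I. a i * M j i) = 0"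
      using insert.IH[OF insert.prems(1), of M] by blast
    then show ?thesis
      using True by (intro exI[of _ a]) auto
  next
    case False
    then obtain k where k: "k \<in> I" "M j0 k \<noteq> 0" by auto
    \<comment> \<open>The coefficients after eliminating the unknown \<open>k\<close> by means of
      equation \<open>j0\<close>; below, \<open>b\<close> restores the value at \<open>k\<close> by
      back substitution.\<close>
    define N where "N j i = M j i - M j k * M j0 i / M j0 k" for j i
    have "card J < card (I - {k})"
      using insert k by simp
    then obtain a where a: "\<exists>i\<in>I - {k}. a i \<noteq> 0" "\<forall>j\<in>J. (\<Sum>i\<in>I - {k}. a i * N j i) = 0"
      using insert.IH[of "I - {k}" N] insert.prems(1) by blast
    define s where "s = (\<Sum>i\<in>I - {k}. a i * M j0 i)"
    define b where "b = a(k := - s / M j0 k)"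
    have b: "(\<Sum>i\<in>I. b i * M j i) = (\<Sum>i\<in>I - {k}. a i * M j i) - s / M j0 k * M j k" for j
    proof -
      have "(\<Sum>i\<in>I. b i * M j i) = b k * M j k + (\<Sum>i\<in>I - {k}. b i * M j i)"
        using insert.prems k by (simp add: sum.remove)
      also have "(\<Sum>i\<in>I - {k}. b i * M j i) = (\<Sum>i\<in>I - {k}. a i * M j i)"
        by (intro sum.cong) (auto simp: b_def)
      finally show ?thesis
        by (simp add: b_def)
    qed
    have "(\<Sum>i\<in>I. b i * M j i) = 0" if "j \<in> J" for j
    proof -
      have "(\<Sum>i\<in>I - {k}. a i * N j i) = (\<Sum>i\<in>I - {k}. a i * M j i) - s / M j0 k * M j k"
      proof -
        have "a i * N j i = a i * M j i - M j k / M j0 k * (a i * M j0 i)" for i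
          by (simp add: N_def right_diff_distrib)
        then have "(\<Sum>i\<in>I - {k}. a i * N j i) = (\<Sum>i\<in>I - {k}. a i * M j i) - M j k / M j0 k * s"
          by (simp only: s_def sum_subtractf sum_distrib_left)
        then show ?thesis
          by simp
      qed
      then show ?thesis
        using a that b by simp
    qed
    moreover have "(\<Sum>i\<in>I. b i * M j0 i) = 0"
      using k by (simp add: b flip: s_def)
    moreover have "\<exists>i\<in>I. b i \<noteq> 0"
      using a(1) by (auto simp: b_def)
    ultimately show ?thesis
      by (intro exI[of _ b]) auto
  qed
qed

section \<open>The inner product on \<open>L\<^sup>2(-1, 1)\<close>\<close>

lemma cnj_measurable [measurable]: "cnj \<in> borel_measurable borel"
  by (intro borel_measurable_continuous_onI continuous_intros)

lemma integrable_mult_cnj: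
  assumes "square_integrable f" "square_integrable g"
  shows "integrable L_interval (\<lambda>x. f x * cnj (g x))"
proof (rule Bochner_Integration.integrable_bound)
  show "integrable L_interval (\<lambda>x. (cmod (f x))\<^sup>2 + (cmod (g x))\<^sup>2)"
    using assms by (auto simp: square_integrable_def)
  have [measurable]: "f \<in> borel_measurable L_interval" "g \<in> borel_measurable L_interval"
    using assms by (auto simp: square_integrable_def)
  show "(\<lambda>x. f x * cnj (g x)) \<in> borel_measurable L_interval"
    by measurable
  have "cmod (f x) * cmod (g x) \<le> (cmod (f x))\<^sup>2 + (cmod (g x))\<^sup>2" for x
    using sum_squares_bound[of "cmod (f x)" "cmod (g x)"]
      mult_nonneg_nonneg[OF norm_ge_zero norm_ge_zero, of "f x" "g x"] by linarith
  then show "AE x in L_interval. norm (f x * cnj (g x)) \<le> norm ((cmod (f x))\<^sup>2 + (cmod (g x))\<^sup>2)"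
    by (intro AE_I2) (simp add: norm_mult)
qed

lift_definition cinner_L2 :: "L2 \<Rightarrow> L2 \<Rightarrow> complex"
  is "\<lambda>f g. LINT x|L_interval. f x * cnj (g x)"
proof -
  fix f f' g g' :: "real \<Rightarrow> complex"
  assume *: "L2_rel f f'" "L2_rel g g'"
  have [measurable]: "f \<in> borel_measurable L_interval" "g \<in> borel_measurable L_interval"
    "f' \<in> borel_measurable L_interval" "g' \<in> borel_measurable L_interval"
    using * by (auto simp: L2_rel_def square_integrable_def)
  have "AE x in L_interval. f x = f' x" "AE x in L_interval. g x = g' x"
    using * by (auto simp: L2_rel_def)
  then have "AE x in L_interval. f x * cnj (g x) = f' x * cnj (g' x)"
    by eventually_elim simp
  then show "(LINT x|L_interval. f x * cnj (g x)) = (LINT x|L_interval. f' x * cnj (g' x))"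
    by (intro integral_cong_AE) auto
qed

lemma cinner_L2_add_left: "cinner_L2 (f + g) h = cinner_L2 f h + cinner_L2 g h"
  by transfer (simp add: L2_rel_def distrib_right integrable_mult_cnj)

lemma cinner_L2_scale_left: "cinner_L2 (scale_L2 a f) g = a * cinner_L2 f g"
  by transfer (simp add: L2_rel_def mult.assoc)

lemma cinner_L2_commute: "cinner_L2 g f = cnj (cinner_L2 f g)"
proof transfer
  fix f g :: "real \<Rightarrow> complex"
  have "(LINT x|L_interval. g x * cnj (f x)) = (LINT x|L_interval. cnj (f x * cnj (g x)))"
    by (simp add: mult.commute)
  also have "\<dots> = cnj (LINT x|L_interval. f x * cnj (g x))"
    by (rule Bochner_Integration.integral_cnj)
  finally show "(LINT x|L_interval. g x * cnj (f x)) = cnj (LINT x|L_interval. f x * cnj (g x))" .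
qed

lemma cinner_L2_self: "0 \<le> Re (cinner_L2 f f) \<and> (Re (cinner_L2 f f) = 0 \<longrightarrow> f = 0)"
proof (transfer, safe)
  fix f assume "L2_rel f f"
  then have f: "square_integrable f"
    by (simp add: L2_rel_def)
  have eq: "Re (LINT x|L_interval. f x * cnj (f x)) = (LINT x|L_interval. (cmod (f x))\<^sup>2)"
    using integrable_mult_cnj[OF f f]
    by (simp add: complex_norm_square[symmetric] del: of_real_power)
  show "0 \<le> Re (LINT x|L_interval. f x * cnj (f x))"
    unfolding eq by simp
  assume "Re (LINT x|L_interval. f x * cnj (f x)) = 0"
  then have "AE x in L_interval. (cmod (f x))\<^sup>2 = 0"
    unfolding eq using f by (subst (asm) integral_nonneg_eq_0_iff_AE) (auto simp: square_integrable_def)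
  then show "L2_rel f (\<lambda>x. 0)"
    using f square_integrable_zero by (simp add: L2_rel_def)
qed

text \<open>The complex space is viewed as a real one through the real part of
  \<open>cinner_L2\<close>, which gives access to the library on real inner product spaces. Complex
  orthogonality is recovered by \<open>cinner_L2_eq_0_iff\<close>.\<close>

instantiation L2 :: real_inner
begin

definition scaleR_L2 :: "real \<Rightarrow> L2 \<Rightarrow> L2" where "scaleR_L2 r f = scale_L2 (of_real r) f"
definition inner_L2 :: "L2 \<Rightarrow> L2 \<Rightarrow> real" where "inner_L2 f g = Re (cinner_L2 f g)"
definition norm_L2 :: "L2 \<Rightarrow> real" where "norm_L2 f = sqrt (inner f f)"
definition dist_L2 :: "L2 \<Rightarrow> L2 \<Rightarrow> real" where "dist_L2 f g = norm (f - g)"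
definition sgn_L2 :: "L2 \<Rightarrow> L2" where "sgn_L2 f = inverse (norm f) *\<^sub>R f"
definition uniformity_L2 :: "(L2 \<times> L2) filter" where
  "uniformity_L2 = (INF e\<in>{0<..}. principal {(f, g). dist f g < e})"
definition open_L2 :: "L2 set \<Rightarrow> bool" where
  "open_L2 U \<longleftrightarrow> (\<forall>f\<in>U. \<forall>\<^sub>F (f', g) in uniformity. f' = f \<longrightarrow> g \<in> U)"

instance
proof
  fix a b r :: real and f g h :: L2
  show "a *\<^sub>R (f + g) = a *\<^sub>R f + a *\<^sub>R g" "(a + b) *\<^sub>R f = a *\<^sub>R f + b *\<^sub>R f"
    "a *\<^sub>R b *\<^sub>R f = (a * b) *\<^sub>R f" "1 *\<^sub>R f = f"
    by (simp_all add: scaleR_L2_def L2.scale_right_distrib L2.scale_left_distrib)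
  show "inner f g = inner g f"
    unfolding inner_L2_def by (subst cinner_L2_commute) simp
  show "inner (f + g) h = inner f h + inner g h" "inner (r *\<^sub>R f) g = r * inner f g"
    by (simp_all add: inner_L2_def scaleR_L2_def cinner_L2_add_left cinner_L2_scale_left)
  show "0 \<le> inner f f" "norm f = sqrt (inner f f)"
    using cinner_L2_self[of f] by (simp_all add: inner_L2_def norm_L2_def)
  have "cinner_L2 0 0 = 0"
    using cinner_L2_add_left[of 0 0 0] by simp
  then show "inner f f = 0 \<longleftrightarrow> f = 0"
    using cinner_L2_self[of f] by (auto simp: inner_L2_def)
  show "dist f g = norm (f - g)" "sgn f = inverse (norm f) *\<^sub>R f"
    "uniformity = (INF e\<in>{0<..}. principal {(f, g :: L2). dist f g < e})"
    by (simp_all add: dist_L2_def sgn_L2_def uniformity_L2_def divide_inverse)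
  fix U :: "L2 set"
  show "open U \<longleftrightarrow> (\<forall>f\<in>U. \<forall>\<^sub>F (f', g) in uniformity. f' = f \<longrightarrow> g \<in> U)"
    by (rule open_L2_def)
qed

end

section \<open>The finite convolution operator\<close>

lemma exp_complex_measurable [measurable]: "exp \<in> borel_measurable (borel :: complex measure)"
  by (intro borel_measurable_continuous_onI continuous_intros)

lemma id_measurable_L_interval: "(\<lambda>x. x) \<in> borel_measurable L_interval"
  by (rule continuous_imp_measurable_on_sets_lebesgue) auto

text \<open>The exponential has modulus one, so the double integrand has modulus
  \<open>norm (\<phi> s) * norm (h y)\<close> and Fubini applies. The case
  \<open>\<sigma> = - 1\<close> yields the transform of a function, the case
  \<open>\<sigma> = 1\<close> the conjugate transform once \<open>h\<close> is a conjugate.\<close>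

lemma fubini_exp:
  fixes \<phi> h :: "real \<Rightarrow> complex" and \<sigma> :: real
  assumes \<phi>: "integrable lborel \<phi>" and h: "integrable L_interval h"
  shows "integrable lborel (\<lambda>s. \<phi> s * (LINT y|L_interval. exp (\<i> * of_real (s * (\<sigma> * y))) * h y))"
    and "(LINT y|L_interval. (LINT s|lborel. \<phi> s * exp (\<i> * of_real (s * (\<sigma> * y)))) * h y) =
      (LINT s|lborel. \<phi> s * (LINT y|L_interval. exp (\<i> * of_real (s * (\<sigma> * y))) * h y))"
proof -
  interpret L: finite_measure L_interval
    by (rule finite_measure_L_interval)
  interpret pair_sigma_finite lborel L_interval ..
  have [measurable]: "\<phi> \<in> borel_measurable borel" "h \<in> borel_measurable L_interval"
    using \<phi> h by auto
  note [measurable] = id_measurable_L_interval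
  define F where "F = (\<lambda>(s, y). \<phi> s * (exp (\<i> * of_real (s * (\<sigma> * y))) * h y))"
  have norm_F: "norm (F (s, y)) = norm (\<phi> s) * norm (h y)" for s y
    by (simp add: F_def norm_mult)
  have F: "integrable (lborel \<Otimes>\<^sub>M L_interval) F"
  proof (rule Fubini_integrable)
    show "F \<in> borel_measurable (lborel \<Otimes>\<^sub>M L_interval)"
      unfolding F_def by measurable
    show "integrable lborel (\<lambda>s. LINT y|L_interval. norm (F (s, y)))"
      unfolding norm_F using \<phi> by simp
    show "AE s in lborel. integrable L_interval (\<lambda>y. F (s, y))"
    proof (rule AE_I2)
      fix s
      show "integrable L_interval (\<lambda>y. F (s, y))"
      proof (rule Bochner_Integration.integrable_bound)
        show "integrable L_interval (\<lambda>y. norm (\<phi> s) * norm (h y))"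
          using h by simp
        show "(\<lambda>y. F (s, y)) \<in> borel_measurable L_interval"
          unfolding F_def by simp
      qed (simp add: norm_F)
    qed
  qed
  show "integrable lborel (\<lambda>s. \<phi> s * (LINT y|L_interval. exp (\<i> * of_real (s * (\<sigma> * y))) * h y))"
    using integrable_fst'[OF F] by (simp add: F_def)
  have "(LINT y|L_interval. (LINT s|lborel. F (s, y))) = (LINT s|lborel. (LINT y|L_interval. F (s, y)))"
    using F by (intro Fubini_integral) (simp add: case_prod_eta)
  moreover have "(LINT s|lborel. F (s, y)) = (LINT s|lborel. \<phi> s * exp (\<i> * of_real (s * (\<sigma> * y)))) * h y" for y
    by (simp add: F_def flip: mult.assoc)
  moreover have "(LINT y|L_interval. F (s, y)) = \<phi> s * (LINT y|L_interval. exp (\<i> * of_real (s * (\<sigma> * y))) * h y)" for s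
    by (simp add: F_def)
  ultimately show "(LINT y|L_interval. (LINT s|lborel. \<phi> s * exp (\<i> * of_real (s * (\<sigma> * y)))) * h y) =
      (LINT s|lborel. \<phi> s * (LINT y|L_interval. exp (\<i> * of_real (s * (\<sigma> * y))) * h y))"
    by simp
qed

text \<open>The exponent keeps the factor \<open>- 1\<close> so that \<open>fubini_exp\<close> applies with \<open>\<sigma> = - 1\<close>.\<close>

definition fourier :: "(real \<Rightarrow> complex) \<Rightarrow> real \<Rightarrow> complex" where
  "fourier h s = (LINT x|L_interval. exp (\<i> * of_real (s * (- 1 * x))) * h x)"

text \<open>Insert \<open>sech_fourier\<close> for the kernel and exchange integrals twice, first
  for \<open>y\<close>, then for \<open>x\<close>. With two functions rather than one, the formula
  yields the symmetry of \<open>Q c\<close> as well as its positivity.\<close>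

lemma Q_fun_fourier:
  assumes "c > 0" "square_integrable f" "square_integrable g"
  shows "(LINT x|L_interval. Q_fun c f x * cnj (g x)) =
      (LINT s|lborel. of_real (sech (s / c)) * fourier f s * cnj (fourier g s))"
    and "integrable lborel (\<lambda>s. of_real (sech (s / c)) * fourier f s * cnj (fourier g s))"
proof -
  have f: "integrable L_interval f" and g: "integrable L_interval (\<lambda>x. cnj (g x))"
    using assms by (auto intro: integrable_if_square_integrable)
  have s: "integrable lborel (\<lambda>s. complex_of_real (sech (s / c)))"
    using integrable_sech_scaled[OF assms(1)] by (rule integrable_of_real)
  have se: "integrable lborel (\<lambda>s. complex_of_real (sech (s / c)) * exp (\<i> * of_real (s * x)))" for x
    using s
  proof (rule Bochner_Integration.integrable_bound)
    show "(\<lambda>s. complex_of_real (sech (s / c)) * exp (\<i> * of_real (s * x))) \<in> borel_measurable lborel"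
      by measurable
  qed (simp add: norm_mult)
  \<comment> \<open>The factor \<open>exp (\<i> * s * x)\<close> is first absorbed into the weight
    to expose the shape of \<open>fubini_exp\<close>; afterwards it is the kernel of an inverse
    transform, ready for the second exchange.\<close>
  have Qf: "Q_fun c f x = (LINT s|lborel. (of_real (sech (s / c)) * fourier f s) * exp (\<i> * of_real (s * (1 * x))))" for x
  proof -
    have "Q_fun c f x = (LINT y|L_interval. (LINT s|lborel. of_real (sech (s / c)) * exp (\<i> * of_real (s * (x - y)))) * f y)"
      unfolding Q_fun_def by (subst sech_fourier[OF assms(1)]) simp
    also have "\<dots> = (LINT y|L_interval. (LINT s|lborel.
        (of_real (sech (s / c)) * exp (\<i> * of_real (s * x))) * exp (\<i> * of_real (s * (- 1 * y)))) * f y)"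
    proof -
      have "exp (\<i> * of_real (s * (x - y))) = exp (\<i> * of_real (s * x)) * exp (\<i> * of_real (s * (- 1 * y)))"
        for s y by (simp add: algebra_simps flip: exp_add)
      then show ?thesis
        by (simp only: mult.assoc)
    qed
    also have "\<dots> = (LINT s|lborel. (of_real (sech (s / c)) * exp (\<i> * of_real (s * x))) * fourier f s)"
      unfolding fourier_def by (rule fubini_exp(2)[OF se f])
    finally show ?thesis
      by (simp add: mult_ac)
  qed
  have cnj_fourier: "(LINT x|L_interval. exp (\<i> * of_real (s * (1 * x))) * cnj (g x)) = cnj (fourier g s)" for s
    unfolding fourier_def Bochner_Integration.integral_cnj[symmetric] by (simp add: exp_cnj)
  have sf: "integrable lborel (\<lambda>s. of_real (sech (s / c)) * fourier f s)"
    unfolding fourier_def by (rule fubini_exp(1)[OF s f])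
  show "integrable lborel (\<lambda>s. of_real (sech (s / c)) * fourier f s * cnj (fourier g s))"
    using fubini_exp(1)[OF sf g, of 1] unfolding cnj_fourier .
  show "(LINT x|L_interval. Q_fun c f x * cnj (g x)) =
      (LINT s|lborel. of_real (sech (s / c)) * fourier f s * cnj (fourier g s))"
    unfolding Qf using fubini_exp(2)[OF sf g, of 1] unfolding cnj_fourier .
qed

lemma L2_obtain:
  obtains f where "square_integrable f" "F = abs_L2 f"
proof (induction F rule: L2.abs_induct)
  case (1 f)
  then show ?case
    by (auto simp: L2_rel_def)
qed

lemma L2_rel_refl: "L2_rel f f \<longleftrightarrow> square_integrable f"
  by (simp add: L2_rel_def)

lemma cinner_Q_abs:
  assumes "c > 0" "square_integrable f" "square_integrable g"
  shows "cinner_L2 (Q c (abs_L2 f)) (abs_L2 g) =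
      (LINT s|lborel. of_real (sech (s / c)) * fourier f s * cnj (fourier g s))"
  using assms Q_fun_fourier(1)[OF assms]
  by (simp add: Q.abs_eq cinner_L2.abs_eq L2_rel_refl square_integrable_Q_fun)

lemma cinner_Q_sym:
  assumes "c > 0"
  shows "cinner_L2 (Q c F) G = cinner_L2 F (Q c G)"
proof -
  obtain f g where fg: "square_integrable f" "F = abs_L2 f" "square_integrable g" "G = abs_L2 g"
    by (metis L2_obtain)
  have "cinner_L2 F (Q c G) = cnj (cinner_L2 (Q c G) F)"
    by (rule cinner_L2_commute)
  also have "\<dots> = (LINT s|lborel. cnj (of_real (sech (s / c)) * fourier g s * cnj (fourier f s)))"
    unfolding fg cinner_Q_abs[OF assms fg(3,1)] by (rule Bochner_Integration.integral_cnj[symmetric])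
  also have "\<dots> = cinner_L2 (Q c F) G"
    unfolding fg cinner_Q_abs[OF assms fg(1,3)] by (simp add: mult_ac)
  finally show ?thesis ..
qed

lemma inner_Q_abs:
  assumes "c > 0" "square_integrable f"
  shows "inner (Q c (abs_L2 f)) (abs_L2 f) = (LINT s|lborel. sech (s / c) * (cmod (fourier f s))\<^sup>2)"
    and "integrable lborel (\<lambda>s. sech (s / c) * (cmod (fourier f s))\<^sup>2)"
proof -
  have eq: "of_real (sech (s / c)) * fourier f s * cnj (fourier f s) = of_real (sech (s / c) * (cmod (fourier f s))\<^sup>2)" for s
    by (simp add: complex_norm_square mult.assoc del: of_real_power)
  show "integrable lborel (\<lambda>s. sech (s / c) * (cmod (fourier f s))\<^sup>2)"
    using Q_fun_fourier(2)[OF assms assms(2)] unfolding eq by (simp only: complex_of_real_integrable_eq)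
  show "inner (Q c (abs_L2 f)) (abs_L2 f) = (LINT s|lborel. sech (s / c) * (cmod (fourier f s))\<^sup>2)"
    unfolding inner_L2_def cinner_Q_abs[OF assms assms(2)] eq
    by (simp only: integral_complex_of_real Re_complex_of_real)
qed

lemma norm_abs_L2: "square_integrable f \<Longrightarrow> (norm (abs_L2 f))\<^sup>2 = (LINT x|L_interval. (cmod (f x))\<^sup>2)"
  using integrable_mult_cnj[of f f]
  by (simp add: power2_norm_eq_inner inner_L2_def cinner_L2.abs_eq L2_rel_refl
    complex_norm_square[symmetric] del: of_real_power)

section \<open>Boundedness, linearity and compactness of the operator\<close>

lemma norm_abs_L2_le:
  assumes "square_integrable f" "\<And>x. - 1 < x \<Longrightarrow> x < 1 \<Longrightarrow> cmod (f x) \<le> e"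
  shows "(norm (abs_L2 f))\<^sup>2 \<le> 2 * e\<^sup>2"
proof -
  interpret finite_measure L_interval
    by (rule finite_measure_L_interval)
  have "(norm (abs_L2 f))\<^sup>2 = (LINT x|L_interval. (cmod (f x))\<^sup>2)"
    using assms(1) by (rule norm_abs_L2)
  also have "\<dots> \<le> (LINT x|L_interval. e\<^sup>2)"
    using assms by (intro integral_mono) (auto simp: square_integrable_def space_restrict_space intro!: power_mono)
  also have "\<dots> = 2 * e\<^sup>2"
    by (simp add: measure_restrict_space space_restrict_space)
  finally show ?thesis .
qed

text \<open>Integrates \<open>t \<le> 1 + t\<^sup>2\<close> over an interval of length
  \<open>2\<close>, so \<open>3 = 2 + 1\<close>. It makes the bounds for \<open>Q_fun\<close>
  uniform on the unit ball.\<close>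

lemma L1_le_L2:
  assumes "square_integrable f" "norm (abs_L2 f) \<le> 1"
  shows "(LINT x|L_interval. cmod (f x)) \<le> 3"
proof -
  interpret finite_measure L_interval
    by (rule finite_measure_L_interval)
  have int: "integrable L_interval (\<lambda>x. (cmod (f x))\<^sup>2)"
    using assms by (simp add: square_integrable_def)
  have "(LINT x|L_interval. cmod (f x)) \<le> (LINT x|L_interval. 1 + (cmod (f x))\<^sup>2)"
  proof (rule integral_mono)
    fix x
    show "cmod (f x) \<le> 1 + (cmod (f x))\<^sup>2"
    proof -
      have "2 * 1 * cmod (f x) \<le> 1\<^sup>2 + (cmod (f x))\<^sup>2"
        by (rule sum_squares_bound)
      then show ?thesis
        using norm_ge_zero[of "f x"] unfolding one_power2 by linarith
    qed
  qed (use assms int in \<open>auto intro: integrable_if_square_integrable\<close>)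
  also have "\<dots> = 2 + (norm (abs_L2 f))\<^sup>2"
    using int norm_abs_L2[OF assms(1)] by (simp add: measure_restrict_space space_restrict_space)
  also have "\<dots> \<le> 2 + 1\<^sup>2"
    using assms(2) by (intro add_left_mono power_mono) auto
  finally show ?thesis
    by simp
qed

text \<open>The derivative is at most one in modulus since
  \<open>\<bar>sinh z\<bar> \<le> cosh z \<le> (cosh z)\<^sup>2\<close>. Equicontinuity of the
  functions \<open>Q_fun c h\<close>, for \<open>h\<close> in the unit ball, rests on this.\<close>

lemma sech_lipschitz: "\<bar>sech a - sech b\<bar> \<le> \<bar>a - b\<bar>"
proof -
  have "norm (sech a - sech b) \<le> 1 * norm (a - b)"
  proof (rule field_differentiable_bound)
    fix z :: real
    show "(sech has_field_derivative - sinh z / (cosh z)\<^sup>2) (at z within UNIV)"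
      unfolding sech_def[abs_def] by (auto intro!: derivative_eq_intros simp: power2_eq_square)
    have "\<bar>sinh z\<bar> \<le> cosh z * 1"
      using sinh_less_cosh_real[of "\<bar>z\<bar>"] by (simp add: sinh_real_abs)
    also have "\<dots> \<le> cosh z * cosh z"
      by (intro mult_left_mono) (auto simp: cosh_real_ge_1)
    finally show "norm (- sinh z / (cosh z)\<^sup>2) \<le> 1"
      by (simp add: power2_eq_square divide_le_eq)
  qed auto
  then show ?thesis
    by simp
qed

context
  fixes c :: real
  assumes c: "c > 0"
begin

lemma norm_Q_kernel_le: "cmod (complex_of_real (pi * c * sech u) * z) \<le> (pi * c) * cmod z"
proof -
  have "\<bar>pi * c * sech u\<bar> \<le> pi * c"
    using c abs_sech_le_1[of u] by (simp add: abs_mult)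
  then show ?thesis
    unfolding norm_mult norm_of_real by (rule mult_right_mono) simp
qed

lemma Q_kernel_integrable:
  assumes "integrable L_interval h"
  shows "integrable L_interval (\<lambda>y. complex_of_real (pi * c * sech (pi * c / 2 * (x - y))) * h y)"
proof (rule Bochner_Integration.integrable_bound)
  note [measurable] = id_measurable_L_interval
  have [measurable]: "h \<in> borel_measurable L_interval"
    using assms by auto
  show "integrable L_interval (\<lambda>y. (pi * c) * cmod (h y))"
    using assms by auto
  show "(\<lambda>y. complex_of_real (pi * c * sech (pi * c / 2 * (x - y))) * h y) \<in> borel_measurable L_interval"
    by measurable
  show "AE y in L_interval. norm (complex_of_real (pi * c * sech (pi * c / 2 * (x - y))) * h y)
      \<le> norm ((pi * c) * cmod (h y))"
    by (intro AE_I2 order_trans[OF norm_Q_kernel_le]) simp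
qed

lemma norm_Q_fun_le:
  assumes "integrable L_interval h"
  shows "cmod (Q_fun c h x) \<le> pi * c * (LINT y|L_interval. cmod (h y))"
proof -
  have "cmod (Q_fun c h x) \<le> (LINT y|L_interval. (pi * c) * cmod (h y))"
    unfolding Q_fun_def
  proof (rule Bochner_Integration.integral_norm_bound_integral)
    show "norm (complex_of_real (pi * c * sech (pi * c / 2 * (x - y))) * h y) \<le> (pi * c) * cmod (h y)" for y
      by (rule norm_Q_kernel_le)
  qed (use assms Q_kernel_integrable in auto)
  then show ?thesis
    by simp
qed

lemma Q_fun_lipschitz:
  assumes "integrable L_interval h"
  shows "cmod (Q_fun c h x - Q_fun c h x') \<le> pi * c * (pi * c / 2) * \<bar>x - x'\<bar> * (LINT y|L_interval. cmod (h y))"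
proof -
  let ?k = "\<lambda>x y. pi * c * sech (pi * c / 2 * (x - y))"
  have k: "\<bar>?k x y - ?k x' y\<bar> \<le> pi * c * (pi * c / 2) * \<bar>x - x'\<bar>" for y
  proof -
    have "\<bar>sech (pi * c / 2 * (x - y)) - sech (pi * c / 2 * (x' - y))\<bar> \<le>
        \<bar>pi * c / 2 * (x - y) - pi * c / 2 * (x' - y)\<bar>"
      by (rule sech_lipschitz)
    also have "pi * c / 2 * (x - y) - pi * c / 2 * (x' - y) = pi * c / 2 * (x - x')"
      by (simp add: right_diff_distrib)
    also have "\<bar>pi * c / 2 * (x - x')\<bar> = pi * c / 2 * \<bar>x - x'\<bar>"
      using c by (simp add: abs_mult)
    finally have "pi * c * \<bar>sech (pi * c / 2 * (x - y)) - sech (pi * c / 2 * (x' - y))\<bar> \<le>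
        pi * c * (pi * c / 2 * \<bar>x - x'\<bar>)"
      using c by (intro mult_left_mono) auto
    moreover have "?k x y - ?k x' y = pi * c * (sech (pi * c / 2 * (x - y)) - sech (pi * c / 2 * (x' - y)))"
      by (simp only: right_diff_distrib)
    ultimately show ?thesis
      using c by (simp only: abs_mult) (simp add: mult.assoc)
  qed
  have eq: "Q_fun c h x - Q_fun c h x' = (LINT y|L_interval. complex_of_real (?k x y) * h y - complex_of_real (?k x' y) * h y)"
    unfolding Q_fun_def using assms by (intro Bochner_Integration.integral_diff[symmetric] Q_kernel_integrable)
  have "cmod (Q_fun c h x - Q_fun c h x') \<le> (LINT y|L_interval. pi * c * (pi * c / 2) * \<bar>x - x'\<bar> * cmod (h y))"
    unfolding eq
  proof (rule Bochner_Integration.integral_norm_bound_integral)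
    fix y
    have "complex_of_real (?k x y) * h y - complex_of_real (?k x' y) * h y = complex_of_real (?k x y - ?k x' y) * h y"
      by (simp only: of_real_diff left_diff_distrib)
    then show "cmod (complex_of_real (?k x y) * h y - complex_of_real (?k x' y) * h y) \<le>
        pi * c * (pi * c / 2) * \<bar>x - x'\<bar> * cmod (h y)"
      using k[of y] by (simp only: norm_mult norm_of_real) (intro mult_right_mono, auto)
  next
    show "integrable L_interval (\<lambda>y. complex_of_real (?k x y) * h y - complex_of_real (?k x' y) * h y)"
      by (intro Bochner_Integration.integrable_diff Q_kernel_integrable assms)
  qed (use assms in simp)
  then show ?thesis
    by (simp only: Bochner_Integration.integral_mult_right_zero)
qed

lemma inner_Q_sym: "inner (Q c F) G = inner F (Q c G)"
  by (simp add: inner_L2_def cinner_Q_sym[OF c])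

text \<open>Read off from symmetry: against every \<open>H\<close>, the operator is moved to the
  other argument, where additivity and homogeneity are those of the inner product.\<close>

lemma linear_Q: "linear (Q c)"
proof
  fix F G :: L2 and a :: real
  have "inner (Q c (F + G)) H = inner (Q c F + Q c G) H" for H
    by (simp add: inner_Q_sym inner_add_left)
  then show "Q c (F + G) = Q c F + Q c G"
    by (subst vector_eq_rdot[symmetric]) blast
  have "inner (Q c (a *\<^sub>R F)) H = inner (a *\<^sub>R Q c F) H" for H
    by (simp add: inner_Q_sym)
  then show "Q c (a *\<^sub>R F) = a *\<^sub>R Q c F"
    by (subst vector_eq_rdot[symmetric]) blast
qed

lemma inner_Q_nonneg: "inner (Q c F) F \<ge> 0"
proof -
  obtain f where f: "square_integrable f" "F = abs_L2 f"
    by (rule L2_obtain)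
  show ?thesis
    unfolding f(2) inner_Q_abs(1)[OF c f(1)] by (intro Bochner_Integration.integral_nonneg) (auto simp: sech_pos less_imp_le)
qed

text \<open>For a unit vector the image is bounded pointwise by \<open>3 * pi * c\<close>, so its
  squared norm is at most \<open>2 * (3 * pi * c)\<^sup>2\<close>, below
  \<open>(6 * pi * c)\<^sup>2\<close>.\<close>

lemma norm_Q_le: "norm (Q c F) \<le> (6 * pi * c) * norm F"
proof (cases "F = 0")
  case False
  obtain f where f: "square_integrable f" "(1 / norm F) *\<^sub>R F = abs_L2 f"
    by (rule L2_obtain)
  have n1: "norm (abs_L2 f) = 1"
    unfolding f(2)[symmetric] using False by simp
  have "cmod (Q_fun c f x) \<le> pi * c * 3" for x
    using norm_Q_fun_le[OF integrable_if_square_integrable[OF f(1)], of x] L1_le_L2[OF f(1)] n1 c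
    by (intro order_trans[OF norm_Q_fun_le[OF integrable_if_square_integrable[OF f(1)]]] mult_left_mono) auto
  then have "(norm (abs_L2 (Q_fun c f)))\<^sup>2 \<le> 2 * (pi * c * 3)\<^sup>2"
    using f(1) by (intro norm_abs_L2_le square_integrable_Q_fun) auto
  also have "\<dots> \<le> (6 * pi * c)\<^sup>2"
    by (simp add: power_mult_distrib)
  finally have "norm (abs_L2 (Q_fun c f)) \<le> 6 * pi * c"
    by (rule power2_le_imp_le) (use c in simp)
  then have "norm (Q c ((1 / norm F) *\<^sub>R F)) \<le> 6 * pi * c"
    unfolding f(2) using f(1) by (simp add: Q.abs_eq L2_rel_refl)
  then show ?thesis
    using False by (simp add: linear_scale[OF linear_Q] pos_divide_le_eq)
qed (simp add: linear_0[OF linear_Q])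

text \<open>Arzela-Ascoli: the images of the unit ball are uniformly bounded with a common Lipschitz
  constant. \<open>Q_fun\<close> is defined at every real point, so the closed interval can be used,
  and uniform convergence there gives convergence in norm on the interval of length
  \<open>2\<close>.\<close>

lemma Q_compact:
  assumes "\<And>n. norm (X n) \<le> 1"
  shows "\<exists>r l. strict_mono (r :: nat \<Rightarrow> nat) \<and> (\<lambda>n. Q c (X (r n))) \<longlonglongrightarrow> l"
proof -
  have "\<forall>n. \<exists>f. square_integrable f \<and> X n = abs_L2 f"
  proof
    fix n
    obtain f where "square_integrable f" "X n = abs_L2 f"
      by (rule L2_obtain)
    then show "\<exists>f. square_integrable f \<and> X n = abs_L2 f"
      by blast
  qed
  from choice[OF this] obtain f where f: "\<And>n. square_integrable (f n)" "\<And>n. X n = abs_L2 (f n)"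
    by blast
  have int: "integrable L_interval (f n)" for n
    using f(1) by (rule integrable_if_square_integrable)
  have L1: "(LINT y|L_interval. cmod (f n y)) \<le> 3" for n
    using L1_le_L2[OF f(1)] assms[of n] f(2) by simp
  have bdd: "cmod (Q_fun c (f n) x) \<le> pi * c * 3" for n x
    using L1[of n] c by (intro order_trans[OF norm_Q_fun_le[OF int]] mult_left_mono) auto
  have lip: "cmod (Q_fun c (f n) x - Q_fun c (f n) y) \<le> pi * c * (pi * c / 2) * \<bar>x - y\<bar> * 3" for n x y
    using L1[of n] c by (intro order_trans[OF Q_fun_lipschitz[OF int]] mult_left_mono) auto
  define D where "D = pi * c * (pi * c / 2) * 3"
  have "D > 0"
    using c by (simp add: D_def)
  obtain g r where g: "continuous_on {-1..1} g" and r: "strict_mono (r :: nat \<Rightarrow> nat)"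
    and lim: "\<And>e. 0 < e \<Longrightarrow> \<exists>N. \<forall>n x. n \<ge> N \<and> x \<in> {-1..1} \<longrightarrow> norm (Q_fun c (f (r n)) x - g x) < e"
  proof (rule Arzela_Ascoli[of "{-1..1::real}" "\<lambda>n. Q_fun c (f n)" "pi * c * 3"])
    show "\<exists>d>0. \<forall>n y. y \<in> {-1..1} \<and> norm (x - y) < d \<longrightarrow> norm (Q_fun c (f n) x - Q_fun c (f n) y) < e"
      if "0 < e" for x e :: real
    proof (intro exI[of _ "e / D"] conjI allI impI)
      show "e / D > 0"
        using that \<open>D > 0\<close> by simp
      fix n y assume "y \<in> {-1..1} \<and> norm (x - y) < e / D"
      then have "D * \<bar>x - y\<bar> < e"
        using \<open>D > 0\<close> by (simp add: field_simps)
      then show "norm (Q_fun c (f n) x - Q_fun c (f n) y) < e"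
        using lip[of n x y] by (simp add: D_def mult_ac)
    qed
  qed (use bdd in auto)
  have g_sq: "square_integrable g"
  proof -
    interpret finite_measure L_interval
      by (rule finite_measure_L_interval)
    have [measurable]: "g \<in> borel_measurable L_interval"
      using g by (intro continuous_imp_measurable_on_sets_lebesgue) (auto intro: continuous_on_subset)
    have "bounded (g ` {-1..1})"
      using g by (intro compact_imp_bounded compact_continuous_image) auto
    then obtain B where B: "\<And>x. x \<in> {-1..1} \<Longrightarrow> cmod (g x) \<le> B"
      unfolding bounded_iff by blast
    have "integrable L_interval (\<lambda>x. (cmod (g x))\<^sup>2)"
      by (rule integrable_const_bound[of _ "B\<^sup>2"])
        (auto intro!: AE_I2 power_mono B simp: space_restrict_space)
    then show ?thesis
      by (simp add: square_integrable_def)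
  qed
  have "(\<lambda>n. Q c (X (r n))) \<longlonglongrightarrow> abs_L2 g"
  proof (rule metric_LIMSEQ_I)
    fix e :: real
    assume "e > 0"
    then obtain N where N: "\<And>n x. n \<ge> N \<Longrightarrow> x \<in> {-1..1} \<Longrightarrow> norm (Q_fun c (f (r n)) x - g x) < e / 2"
      using lim[of "e / 2"] by auto
    have "dist (Q c (X (r n))) (abs_L2 g) < e" if "n \<ge> N" for n
    proof -
      have sq: "square_integrable (\<lambda>x. Q_fun c (f (r n)) x - g x)"
        by (intro square_integrable_diff square_integrable_Q_fun f g_sq)
      have "Q c (X (r n)) - abs_L2 g = abs_L2 (\<lambda>x. Q_fun c (f (r n)) x - g x)"
        by (simp add: f(2) Q.abs_eq minus_L2.abs_eq L2_rel_refl f(1) g_sq square_integrable_Q_fun)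
      moreover have "(norm (abs_L2 (\<lambda>x. Q_fun c (f (r n)) x - g x)))\<^sup>2 \<le> 2 * (e / 2)\<^sup>2"
        using sq N[OF that] by (intro norm_abs_L2_le) (auto intro: less_imp_le)
      moreover have "2 * (e / 2)\<^sup>2 < e\<^sup>2"
        using \<open>e > 0\<close> by (simp add: power_divide)
      ultimately have "(norm (Q c (X (r n)) - abs_L2 g))\<^sup>2 < e\<^sup>2"
        by simp
      then show ?thesis
        using \<open>e > 0\<close> by (simp add: dist_norm power2_less_imp_less)
    qed
    then show "\<exists>N. \<forall>n\<ge>N. dist (Q c (X (r n))) (abs_L2 g) < e"
      by blast
  qed
  then show ?thesis
    using r by blast
qed

end

section \<open>The min-max principle\<close>

text \<open>Pairing with \<open>scale_L2 \<i> G\<close> multiplies the product by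
  \<open>- \<i>\<close>, so its real part is the imaginary part of
  \<open>cinner_L2 F G\<close>.\<close>

lemma cinner_L2_eq_0_iff:
  "cinner_L2 F G = 0 \<longleftrightarrow> inner F G = 0 \<and> inner F (scale_L2 \<i> G) = 0"
proof -
  have "cinner_L2 F (scale_L2 \<i> G) = cnj (\<i> * cinner_L2 G F)"
    by (metis cinner_L2_commute cinner_L2_scale_left)
  also have "\<dots> = - \<i> * cinner_L2 F G"
    by (subst (2) cinner_L2_commute) simp
  finally show ?thesis
    by (simp add: inner_L2_def complex_eq_iff)
qed

lemma cinner_L2_0_left: "cinner_L2 0 G = 0"
  using cinner_L2_scale_left[of 0 0 G] by simp

lemma cinner_L2_sum_left: "cinner_L2 (\<Sum>k\<in>K. F k) G = (\<Sum>k\<in>K. cinner_L2 (F k) G)"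
  by (induction K rule: infinite_finite_induct) (simp_all add: cinner_L2_0_left cinner_L2_add_left)

lemma closed_orthogonal_L2: "closed {F. \<forall>j\<in>J. cinner_L2 F (G j) = 0}"
proof -
  have "{F. \<forall>j\<in>J. cinner_L2 F (G j) = 0} =
      (\<Inter>j\<in>J. {F. inner F (G j) = 0} \<inter> {F. inner F (scale_L2 \<i> (G j)) = 0})"
    by (auto simp: cinner_L2_eq_0_iff)
  also have "closed \<dots>"
    by (intro closed_INT ballI closed_Int closed_Collect_eq continuous_intros)
  finally show ?thesis .
qed

text \<open>
  The lower half of the Courant--Fischer principle: if \<open>\<rho> m < t\<close>, then some nonzero combination of
  the \<open>m + 1\<close> trial functions is orthogonal to the first \<open>m\<close> eigenfunctions, so \<open>T\<close> has an
  eigenfunction orthogonal to them with eigenvalue at least \<open>t\<close>, for which no place is left in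
  the list.
\<close>

lemma decreasing_eigenvalues_ge:
  fixes T :: "L2 \<Rightarrow> L2" and \<phi> :: "nat \<Rightarrow> L2"
  assumes ev: "decreasing_eigenvalues T \<rho>"
    and lin: "linear T"
    and csym: "\<And>F G. cinner_L2 (T F) G = cinner_L2 F (T G)"
    and psd: "\<And>F. inner (T F) F \<ge> 0"
    and bounded: "\<And>F. norm (T F) \<le> K * norm F"
    and compact: "\<And>X. (\<And>n. norm (X n) \<le> 1) \<Longrightarrow>
      \<exists>r l. strict_mono (r :: nat \<Rightarrow> nat) \<and> (\<lambda>n. T (X (r n))) \<longlonglongrightarrow> l"
    and "t > 0"
    and trial: "\<And>a F. (\<exists>k\<le>m. a k \<noteq> 0) \<Longrightarrow> F = (\<Sum>k\<le>m. scale_L2 (a k) (\<phi> k)) \<Longrightarrow>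
      F \<noteq> 0 \<and> t * (norm F)\<^sup>2 \<le> inner (T F) F"
  shows "t \<le> \<rho> m"
proof (rule ccontr)
  assume "\<not> t \<le> \<rho> m"
  have dec: "decseq \<rho>"
    using ev unfolding decreasing_eigenvalues_def by (rule conjunct1)
  have "\<forall>\<mu>. \<exists>B b. L2.span B = eigenspace T \<mu> \<and> bij_betw b {j. complex_of_real (\<rho> j) = \<mu>} B"
    using ev unfolding decreasing_eigenvalues_def eqpoll_def by blast
  then obtain B where "\<forall>\<mu>. \<exists>b. L2.span (B \<mu>) = eigenspace T \<mu> \<and> bij_betw b {j. complex_of_real (\<rho> j) = \<mu>} (B \<mu>)"
    by (rule choice[THEN exE])
  then obtain b where Bb: "\<forall>\<mu>. L2.span (B \<mu>) = eigenspace T \<mu> \<and> bij_betw (b \<mu>) {j. complex_of_real (\<rho> j) = \<mu>} (B \<mu>)"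
    by (rule choice[THEN exE])
  \<comment> \<open>The bijections for the different eigenvalues are glued into one sequence:
    \<open>e j\<close> is the basis vector attached to place \<open>j\<close>, and each basis
    \<open>B \<mu>\<close> consists of the \<open>e j\<close> with
    \<open>\<rho> j = \<mu>\<close>.\<close>
  define e where "e j = b (complex_of_real (\<rho> j)) j" for j
  have B: "B \<mu> = e ` {j. complex_of_real (\<rho> j) = \<mu>}" for \<mu>
  proof -
    have "B \<mu> = b \<mu> ` {j. complex_of_real (\<rho> j) = \<mu>}"
      using Bb by (simp add: bij_betw_def)
    also have "\<dots> = e ` {j. complex_of_real (\<rho> j) = \<mu>}"
      by (intro image_cong) (auto simp: e_def)
    finally show ?thesis .
  qed
  have Te: "T (e j) = scale_L2 (of_real (\<rho> j)) (e j)" for j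
  proof -
    have "e j \<in> B (of_real (\<rho> j))"
      unfolding B by blast
    then have "e j \<in> eigenspace T (of_real (\<rho> j))"
      using Bb L2.span_base by blast
    then show ?thesis
      by (simp add: eigenspace_def)
  qed
  define W where "W = {F. \<forall>j\<in>{..<m}. cinner_L2 F (e j) = 0}"
  obtain a where a: "\<exists>k\<in>{..m}. a k \<noteq> 0"
    "\<forall>j\<in>{..<m}. (\<Sum>k\<in>{..m}. a k * cinner_L2 (\<phi> k) (e j)) = 0"
    using homogeneous_system_nontrivial[of "{..<m}" "{..m}" "\<lambda>j k. cinner_L2 (\<phi> k) (e j)"] by auto
  define F where "F = (\<Sum>k\<le>m. scale_L2 (a k) (\<phi> k))"
  have "F \<noteq> 0" "t * (norm F)\<^sup>2 \<le> inner (T F) F"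
    using trial[OF _ F_def] a(1) by auto
  moreover have "F \<in> W"
    using a(2) by (simp add: W_def F_def cinner_L2_sum_left cinner_L2_scale_left)
  moreover have "subspace W"
    by (auto simp: W_def subspace_def cinner_L2_0_left cinner_L2_add_left cinner_L2_scale_left scaleR_L2_def)
  moreover have "closed W"
    unfolding W_def by (rule closed_orthogonal_L2)
  moreover have "T G \<in> W" if "G \<in> W" for G
  proof -
    have "cinner_L2 (T G) (e j) = 0" if "j < m" for j
    proof -
      have "cinner_L2 (T G) (e j) = cnj (cinner_L2 (scale_L2 (of_real (\<rho> j)) (e j)) G)"
        unfolding csym Te by (rule cinner_L2_commute)
      also have "\<dots> = of_real (\<rho> j) * cinner_L2 G (e j)"
        by (subst (2) cinner_L2_commute) (simp add: cinner_L2_scale_left)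
      finally show ?thesis
        using \<open>G \<in> W\<close> that by (simp add: W_def)
    qed
    then show ?thesis
      by (simp add: W_def)
  qed
  moreover have "inner (T G) H = inner G (T H)" for G H
    by (simp add: inner_L2_def csym)
  ultimately obtain G \<mu> where G: "G \<in> W" "G \<noteq> 0" and \<mu>: "\<mu> \<ge> t" "T G = \<mu> *\<^sub>R G"
    using compact_symmetric_has_eigenvector[OF lin _ psd bounded compact, of W F t] \<open>t > 0\<close> by blast
  \<comment> \<open>Since \<open>\<mu> \<ge> t > \<rho> m\<close>, the value \<open>\<mu>\<close>
    can occur only at places below \<open>m\<close>. All basis vectors of its eigenspace are then
    orthogonal to \<open>G\<close>, although \<open>G\<close> lies in their span, so
    \<open>G\<close> is orthogonal to itself.\<close>
  have "e j \<in> {H. cinner_L2 G H = 0}" if "\<rho> j = \<mu>" for j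
  proof -
    have "j < m"
    proof (rule ccontr)
      assume "\<not> j < m"
      then have "\<rho> j \<le> \<rho> m"
        using dec by (simp add: decseq_def)
      then show False
        using \<open>\<not> t \<le> \<rho> m\<close> \<mu>(1) that by simp
    qed
    then show ?thesis
      using G(1) by (simp add: W_def)
  qed
  then have "B (of_real \<mu>) \<subseteq> {H. cinner_L2 G H = 0}"
    unfolding B by auto
  moreover have "L2.subspace {H. cinner_L2 G H = 0}"
  proof (rule L2.subspaceI)
    have eq: "cinner_L2 G H = cnj (cinner_L2 H G)" for H
      by (rule cinner_L2_commute)
    show "0 \<in> {H. cinner_L2 G H = 0}"
      by (simp add: eq cinner_L2_0_left)
    show "x + y \<in> {H. cinner_L2 G H = 0}" if "x \<in> {H. cinner_L2 G H = 0}" "y \<in> {H. cinner_L2 G H = 0}" for x y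
      using that by (simp add: eq cinner_L2_add_left)
    show "scale_L2 r x \<in> {H. cinner_L2 G H = 0}" if "x \<in> {H. cinner_L2 G H = 0}" for r x
      using that by (simp add: eq cinner_L2_scale_left)
  qed
  ultimately have "L2.span (B (of_real \<mu>)) \<subseteq> {H. cinner_L2 G H = 0}"
    by (rule L2.span_minimal)
  moreover have "G \<in> L2.span (B (of_real \<mu>))"
    using Bb \<mu>(2) by (simp add: eigenspace_def scaleR_L2_def)
  ultimately have "cinner_L2 G G = 0"
    by blast
  then show False
    using G(2) by (simp add: cinner_L2_eq_0_iff)
qed

lemma Q_eigenvalue_ge:
  assumes "c > 0" "decreasing_eigenvalues (Q c) \<rho>" "t > 0"
    and "\<And>a F. (\<exists>k\<le>m. a k \<noteq> 0) \<Longrightarrow> F = (\<Sum>k\<le>m. scale_L2 (a k) (\<phi> k)) \<Longrightarrow>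
      F \<noteq> 0 \<and> t * (norm F)\<^sup>2 \<le> inner (Q c F) F"
  shows "t \<le> \<rho> m"
proof (rule decreasing_eigenvalues_ge[where T = "Q c" and \<phi> = \<phi>])
  show "cinner_L2 (Q c F) G = cinner_L2 F (Q c G)" for F G
    using assms(1) by (rule cinner_Q_sym)
qed (fact assms linear_Q[OF assms(1)] inner_Q_nonneg[OF assms(1)] norm_Q_le[OF assms(1)] Q_compact[OF assms(1)])+

section \<open>Trial functions and the lower bounds\<close>

text \<open>Passes from Lebesgue measure on the interval to \<open>lborel\<close>, where the affine
  substitutions for shifted bumps are available.\<close>

lemma L_interval_eq_lborel:
  fixes f :: "real \<Rightarrow> 'a :: {banach, second_countable_topology}"
  assumes f: "f \<in> borel_measurable borel" and "\<And>x. x \<notin> {-1<..<1} \<Longrightarrow> f x = 0"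
  shows "(LINT x|L_interval. f x) = (LINT x|lborel. f x)"
    and "integrable L_interval f \<longleftrightarrow> integrable lborel f"
proof -
  have eq: "(\<lambda>x. indicator {-1<..<1} x *\<^sub>R f x) = f"
    using assms(2) by (auto simp: indicator_def fun_eq_iff)
  have fl: "f \<in> borel_measurable lborel"
    using f by simp
  show "(LINT x|L_interval. f x) = (LINT x|lborel. f x)"
    using integral_completion[OF fl] by (subst integral_restrict_space) (simp_all add: eq)
  show "integrable L_interval f \<longleftrightarrow> integrable lborel f"
    using integrable_completion[OF fl] by (subst integrable_restrict_space) (simp_all add: eq)
qed

text \<open>The first Dirichlet eigenfunction of an interval of length \<open>w\<close>. Its
  frequency \<open>pi / w\<close> is the largest \<open>\<bar>s\<bar>\<close> in the full period, so
  the comparison with \<open>cos (s * u)\<close> covers that whole range.\<close>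

definition bump :: "real \<Rightarrow> real \<Rightarrow> real" where
  "bump w u = indicator {- w / 2<..<w / 2} u * cos (pi * u / w)"

lemma bump_measurable [measurable]: "bump w \<in> borel_measurable borel"
  unfolding bump_def[abs_def] by measurable

lemma bump_mult_integrable:
  fixes g :: "real \<Rightarrow> complex"
  assumes "w > 0" "\<And>A. continuous_on A g"
  shows "integrable lborel (\<lambda>u. of_real (bump w u) * g u)"
proof -
  have "set_integrable lborel {- w / 2..w / 2} (\<lambda>u. of_real (cos (pi * u / w)) * g u)"
    using assms(1) by (intro borel_integrable_atLeastAtMost' continuous_intros assms(2)) simp_all
  then have "set_integrable lborel {- w / 2<..<w / 2} (\<lambda>u. of_real (cos (pi * u / w)) * g u)"
    by (rule set_integrable_subset) auto
  then show ?thesis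
    by (simp add: set_integrable_def bump_def scaleR_conv_of_real mult.assoc of_real_indicator)
qed

lemma bump_square_integral:
  assumes "w > 0"
  shows "has_bochner_integral lborel (\<lambda>u. (bump w u)\<^sup>2) (w / 2)"
proof -
  have "has_bochner_integral lborel (\<lambda>u. (cos (pi * u / w))\<^sup>2 * indicator {- w / 2..w / 2} u)
     ((w / 2 / 2 + w / (4 * pi) * sin (2 * pi * (w / 2) / w)) - (- w / 2 / 2 + w / (4 * pi) * sin (2 * pi * (- w / 2) / w)))"
  proof (rule has_bochner_integral_FTC_Icc_real)
    fix u
    have "((\<lambda>u. u / 2 + w / (4 * pi) * sin (2 * pi * u / w)) has_real_derivative
        1 / 2 + w / (4 * pi) * (cos (2 * pi * u / w) * (2 * pi / w))) (at u)"
      using assms by (auto intro!: derivative_eq_intros)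
    moreover have "1 / 2 + w / (4 * pi) * (cos (2 * pi * u / w) * (2 * pi / w)) = (cos (pi * u / w))\<^sup>2"
    proof -
      have "cos (2 * pi * u / w) = 2 * (cos (pi * u / w))\<^sup>2 - 1"
        using cos_double_cos[of "pi * u / w"] by (simp add: mult.assoc)
      moreover have "w / (4 * pi) * (cos (2 * pi * u / w) * (2 * pi / w)) = cos (2 * pi * u / w) / 2"
        using assms by (simp add: field_simps)
      ultimately show ?thesis
        by simp
    qed
    ultimately show "((\<lambda>u. u / 2 + w / (4 * pi) * sin (2 * pi * u / w)) has_real_derivative (cos (pi * u / w))\<^sup>2) (at u)"
      by simp
  qed (use assms in \<open>auto intro!: continuous_intros\<close>)
  moreover have "(w / 2 / 2 + w / (4 * pi) * sin (2 * pi * (w / 2) / w)) - (- w / 2 / 2 + w / (4 * pi) * sin (2 * pi * (- w / 2) / w)) = w / 2"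
    using assms by simp
  moreover have "(\<lambda>u. (cos (pi * u / w))\<^sup>2 * indicator {- w / 2..w / 2} u) = (\<lambda>u. (bump w u)\<^sup>2)"
  proof
    fix u
    consider "\<bar>u\<bar> = w / 2" | "\<bar>u\<bar> < w / 2" | "\<bar>u\<bar> > w / 2"
      by linarith
    then show "(cos (pi * u / w))\<^sup>2 * indicator {- w / 2..w / 2} u = (bump w u)\<^sup>2"
    proof cases
      case 1
      then have "pi * u / w = pi / 2 \<or> pi * u / w = - (pi / 2)"
        using assms by (auto simp: abs_if field_simps split: if_splits)
      then have "cos (pi * u / w) = 0"
        using cos_pi_half cos_minus by metis
      then show ?thesis
        by (simp add: bump_def)
    next
      case 2
      then show ?thesis
        by (simp add: bump_def indicator_def abs_less_iff) linarith
    next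
      case 3
      then show ?thesis
        by (simp add: bump_def indicator_def) linarith
    qed
  qed
  ultimately show ?thesis
    by (simp only:)
qed

definition bump_fourier :: "real \<Rightarrow> real \<Rightarrow> complex" where
  "bump_fourier w s = (LINT u|lborel. of_real (bump w u) * exp (\<i> * of_real (s * (- 1 * u))))"

text \<open>
  On the support of the bump \<open>cos (s u) \<ge> cos (\<pi> u / w)\<close>, so its Fourier transform dominates the
  integral of its square.
\<close>

lemma norm_bump_fourier_ge:
  assumes w: "w > 0" and s: "\<bar>s\<bar> \<le> pi / w"
  shows "w / 2 \<le> cmod (bump_fourier w s)"
proof -
  have int: "integrable lborel (\<lambda>u. complex_of_real (bump w u) * exp (\<i> * of_real (s * (- 1 * u))))"
    by (intro bump_mult_integrable continuous_intros w)
  have Re: "Re (complex_of_real (bump w u) * exp (\<i> * of_real (s * (- 1 * u)))) = bump w u * cos (s * u)" for u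
    by (simp add: Re_exp)
  have "w / 2 = (LINT u|lborel. (bump w u)\<^sup>2)"
    using bump_square_integral[OF w] by (simp add: has_bochner_integral_integral_eq)
  also have "\<dots> \<le> (LINT u|lborel. bump w u * cos (s * u))"
  proof (rule integral_mono)
    show "integrable lborel (\<lambda>u. (bump w u)\<^sup>2)"
      using bump_square_integral[OF w] by (simp add: has_bochner_integral_iff)
    show "integrable lborel (\<lambda>u. bump w u * cos (s * u))"
      using integrable_Re[OF int] unfolding Re .
    fix u
    show "(bump w u)\<^sup>2 \<le> bump w u * cos (s * u)"
    proof (cases "\<bar>u\<bar> < w / 2")
      case True
      have le: "\<bar>s * u\<bar> \<le> \<bar>pi * u / w\<bar>"
        using mult_right_mono[OF s, of "\<bar>u\<bar>"] w by (simp add: abs_mult)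
      have lt: "\<bar>pi * u / w\<bar> < pi / 2"
        using True w by (simp add: abs_mult field_simps)
      have "cos \<bar>pi * u / w\<bar> \<le> cos \<bar>s * u\<bar>"
        using le lt pi_gt_zero by (intro cos_monotone_0_pi_le) linarith+
      moreover have "cos \<bar>pi * u / w\<bar> > 0"
        using lt by (intro cos_gt_zero_pi) linarith+
      moreover have "bump w u = cos (pi * u / w)"
      proof -
        have "- w / 2 < u" "u < w / 2"
          using True by linarith+
        then show ?thesis
          by (simp add: bump_def)
      qed
      ultimately show ?thesis
        unfolding cos_abs_real power2_eq_square by (simp add: mult_left_mono)
    next
      case False
      then have "bump w u = 0"
        by (auto simp: bump_def indicator_def)
      then show ?thesis
        by simp
    qed
  qed
  also have "\<dots> = Re (bump_fourier w s)"
    unfolding bump_fourier_def Re[symmetric] by (rule integral_Re[OF int])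
  also have "\<dots> \<le> cmod (bump_fourier w s)"
    by (rule complex_Re_le_cmod)
  finally show ?thesis .
qed

lemma scale_L2_sum_abs:
  assumes "\<And>k. k \<in> K \<Longrightarrow> square_integrable (f k)"
  shows "square_integrable (\<lambda>x. \<Sum>k\<in>K. a k * f k x) \<and>
    (\<Sum>k\<in>K. scale_L2 (a k) (abs_L2 (f k))) = abs_L2 (\<lambda>x. \<Sum>k\<in>K. a k * f k x)"
  using assms
proof (induction K rule: infinite_finite_induct)
  case (insert k K)
  have 1: "square_integrable (f k)" "square_integrable (\<lambda>x. a k * f k x)"
    using insert.prems by (auto intro: square_integrable_scale)
  have 2: "square_integrable (\<lambda>x. \<Sum>k\<in>K. a k * f k x)"
    "(\<Sum>k\<in>K. scale_L2 (a k) (abs_L2 (f k))) = abs_L2 (\<lambda>x. \<Sum>k\<in>K. a k * f k x)"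
    using insert.IH insert.prems by auto
  have "scale_L2 (a k) (abs_L2 (f k)) + abs_L2 (\<lambda>x. \<Sum>k\<in>K. a k * f k x) =
      abs_L2 (\<lambda>x. a k * f k x + (\<Sum>k\<in>K. a k * f k x))"
    using 1 2(1) by (simp add: scale_L2.abs_eq plus_L2.abs_eq L2_rel_refl)
  then show ?case
    using insert.hyps 2(2) square_integrable_add[OF 1(2) 2(1)] by simp
qed (simp_all add: square_integrable_zero zero_L2_def)

lemma has_bochner_integral_indicator_Icc:
  fixes g :: "real \<Rightarrow> real"
  assumes "\<And>A. continuous_on A g"
  shows "has_bochner_integral lborel (\<lambda>t. indicator {a..b} t * g t) (integral {a..b} g)"
proof -
  have "set_integrable lborel {a..b} g"
    by (rule borel_integrable_atLeastAtMost') (rule assms)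
  then show ?thesis
    using set_borel_integral_eq_integral(2)[of "{a..b}" g]
    by (simp add: has_bochner_integral_iff set_integrable_def set_lebesgue_integral_def)
qed

text \<open>The midpoint of the \<open>k\<close>-th of \<open>m + 1\<close> equal subintervals of
  \<open>{-1<..<1}\<close>, counted from \<open>0\<close> at the left.\<close>

definition bump_center :: "nat \<Rightarrow> nat \<Rightarrow> real" where
  "bump_center m k = - 1 + (2 * real k + 1) / real (Suc m)"

definition trial :: "nat \<Rightarrow> nat \<Rightarrow> real \<Rightarrow> complex" where
  "trial m k x = of_real (bump (2 / real (Suc m)) (x - bump_center m k))"

context
  fixes m :: nat and w :: real
  defines "w \<equiv> 2 / real (Suc m)"
begin

lemma w_pos: "w > 0"
  by (simp add: w_def)

lemma bump_center_eq: "bump_center m k = (w / 2 - 1) + real k * w"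
  by (simp add: bump_center_def w_def add_divide_distrib del: of_nat_Suc)

lemma trial_eq: "trial m k x = of_real (bump w (x - bump_center m k))"
  by (simp add: trial_def w_def)

lemma bump_eq_0: "w / 2 \<le> \<bar>u\<bar> \<Longrightarrow> bump w u = 0"
  by (auto simp: bump_def indicator_def)

lemma trial_eq_0:
  assumes "k \<le> m" "x \<notin> {-1<..<1}"
  shows "trial m k x = 0"
proof -
  have 1: "real k * w + w \<le> 2"
  proof -
    have "real k * w + w = 2 * (real k + 1) / real (Suc m)"
      by (simp add: w_def add_divide_distrib del: of_nat_Suc)
    also have "\<dots> \<le> 2 * real (Suc m) / real (Suc m)"
      using assms(1) by (intro divide_right_mono mult_left_mono) auto
    also have "2 * real (Suc m) / real (Suc m) = 2"
      by (simp del: of_nat_Suc)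
    finally show ?thesis .
  qed
  have 2: "0 \<le> real k * w"
    using w_pos by simp
  have "w / 2 \<le> \<bar>x - bump_center m k\<bar>"
  proof -
    have "x \<le> - 1 \<or> 1 \<le> x"
      using assms(2) by auto
    then show ?thesis
      using 1 2 unfolding bump_center_eq by linarith
  qed
  then show ?thesis
    by (simp add: trial_eq bump_eq_0)
qed

lemma trial_measurable [measurable]: "trial m k \<in> borel_measurable borel"
  unfolding trial_eq[abs_def] by measurable

lemma trial_square_integral:
  assumes "k \<le> m"
  shows "(LINT x|L_interval. (cmod (trial m k x))\<^sup>2) = w / 2"
    and "integrable L_interval (\<lambda>x. (cmod (trial m k x))\<^sup>2)"
proof -
  have "has_bochner_integral lborel (\<lambda>x. (bump w (- bump_center m k + 1 * x))\<^sup>2) (w / 2 /\<^sub>R \<bar>1\<bar>)"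
    by (intro lborel_has_bochner_integral_real_affine_iff[THEN iffD1, of 1 "\<lambda>x. (bump w x)\<^sup>2"]
      bump_square_integral w_pos) simp
  then have *: "has_bochner_integral lborel (\<lambda>x. (cmod (trial m k x))\<^sup>2) (w / 2)"
    by (simp add: trial_eq)
  have meas: "(\<lambda>x. (cmod (trial m k x))\<^sup>2) \<in> borel_measurable borel"
    by measurable
  have 0: "(cmod (trial m k x))\<^sup>2 = 0" if "x \<notin> {-1<..<1}" for x
    using trial_eq_0[OF assms that] by simp
  show "(LINT x|L_interval. (cmod (trial m k x))\<^sup>2) = w / 2"
    "integrable L_interval (\<lambda>x. (cmod (trial m k x))\<^sup>2)"
    using * unfolding has_bochner_integral_iff
    by (subst L_interval_eq_lborel; use meas 0 in simp)+
qed

lemma square_integrable_trial: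
  assumes "k \<le> m"
  shows "square_integrable (trial m k)"
proof -
  have "trial m k \<in> borel_measurable L_interval"
    using trial_measurable[of k] by (simp add: measurable_restrict_space1 measurable_completion)
  then show ?thesis
    using trial_square_integral(2)[OF assms] by (simp add: square_integrable_def)
qed

text \<open>A shift by the centre multiplies the transform by a phase. The centres form an
  arithmetic progression with step \<open>w\<close> starting at \<open>w / 2 - 1\<close>, so the
  phases are a common factor times powers of \<open>exp (- \<i> * w * s)\<close>.\<close>

lemma fourier_trial_sum:
  "fourier (\<lambda>x. \<Sum>k\<le>m. a k * trial m k x) s =
    exp (\<i> * of_real (s * (1 - w / 2))) * bump_fourier w s * trigpoly m a (- w * s)"
proof -
  let ?E = "\<lambda>x. exp (\<i> * of_real (s * (- 1 * x)))"
  have E: "(\<lambda>x. ?E x) \<in> borel_measurable borel"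
    by (intro borel_measurable_continuous_onI continuous_intros)
  have int: "integrable lborel (\<lambda>u. of_real (bump w u) * ?E u)"
    by (intro bump_mult_integrable continuous_intros w_pos)
  have shift: "of_real (bump w (- bump_center m k + 1 * x)) * ?E (- bump_center m k + 1 * x) =
      exp (\<i> * of_real (s * bump_center m k)) * (?E x * trial m k x)" for k x
    by (simp add: trial_eq algebra_simps flip: exp_add)
  have cancel: "?E x * (exp (\<i> * of_real (s * x)) * z) = z" for x z
  proof -
    have "?E x * exp (\<i> * of_real (s * x)) = 1"
      by (simp flip: exp_add)
    then show ?thesis
      by (metis mult.assoc mult_1_left)
  qed
  have int': "integrable lborel (\<lambda>x. ?E x * trial m k x)" for k
  proof -
    have "integrable lborel (\<lambda>x. exp (\<i> * of_real (s * bump_center m k)) * (?E x * trial m k x))"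
      using lborel_integrable_real_affine[OF int, of 1 "- bump_center m k"] unfolding shift by simp
    then have "integrable lborel (\<lambda>x. ?E (bump_center m k) *
        (exp (\<i> * of_real (s * bump_center m k)) * (?E x * trial m k x)))"
      by (rule integrable_mult_right)
    then show ?thesis
      by (simp only: cancel)
  qed
  have single: "(LINT x|lborel. ?E x * trial m k x) = ?E (bump_center m k) * bump_fourier w s" for k
  proof -
    have "bump_fourier w s = exp (\<i> * of_real (s * bump_center m k)) * (LINT x|lborel. ?E x * trial m k x)"
      unfolding bump_fourier_def
      by (subst lborel_integral_real_affine[of 1 _ "- bump_center m k"]) (simp_all add: shift[simplified])
    then show ?thesis
      by (simp only: cancel)
  qed
  have "fourier (\<lambda>x. \<Sum>k\<le>m. a k * trial m k x) s = (LINT x|lborel. ?E x * (\<Sum>k\<le>m. a k * trial m k x))"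
    unfolding fourier_def
    by (rule L_interval_eq_lborel(1)) (use E in \<open>measurable, simp add: trial_eq_0\<close>)
  also have "\<dots> = (LINT x|lborel. (\<Sum>k\<le>m. a k * (?E x * trial m k x)))"
    by (simp add: sum_distrib_left mult_ac)
  also have "\<dots> = (\<Sum>k\<le>m. a k * (LINT x|lborel. ?E x * trial m k x))"
    using int' by (subst Bochner_Integration.integral_sum) simp_all
  also have "\<dots> = (\<Sum>k\<le>m. exp (\<i> * of_real (s * (1 - w / 2))) * bump_fourier w s * (a k * exp (\<i> * of_real (real k * (- w * s)))))"
  proof (rule sum.cong)
    fix k
    have "?E (bump_center m k) = exp (\<i> * of_real (s * (1 - w / 2))) * exp (\<i> * of_real (real k * (- w * s)))"
      by (simp add: bump_center_eq algebra_simps flip: exp_add)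
    then show "a k * (LINT x|lborel. ?E x * trial m k x) =
        exp (\<i> * of_real (s * (1 - w / 2))) * bump_fourier w s * (a k * exp (\<i> * of_real (real k * (- w * s))))"
      unfolding single by (simp only: mult_ac)
  qed simp
  also have "\<dots> = exp (\<i> * of_real (s * (1 - w / 2))) * bump_fourier w s * trigpoly m a (- w * s)"
    by (simp only: trigpoly_def sum_distrib_left)
  finally show ?thesis .
qed

lemma norm_trial_sum:
  "(norm (abs_L2 (\<lambda>x. \<Sum>k\<le>m. a k * trial m k x)))\<^sup>2 = w / 2 * (\<Sum>k\<le>m. (cmod (a k))\<^sup>2)"
proof -
  \<comment> \<open>Distinct centres are at least \<open>w\<close> apart, and a bump vanishes from
    distance \<open>w / 2\<close> on.\<close>
  have disjoint: "trial m j x = 0" if "trial m k x \<noteq> 0" "j \<noteq> k" for j k x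
  proof -
    have "\<bar>x - bump_center m k\<bar> < w / 2"
      using that(1) bump_eq_0[of "x - bump_center m k"] by (simp add: trial_eq not_le) (meson not_le)
    moreover have "w \<le> \<bar>bump_center m j - bump_center m k\<bar>"
    proof -
      have "bump_center m j - bump_center m k = (real j - real k) * w"
        by (simp add: bump_center_eq algebra_simps)
      moreover have "1 * w \<le> \<bar>real j - real k\<bar> * w"
        using that(2) w_pos by (intro mult_right_mono) linarith+
      ultimately show ?thesis
        using w_pos by (simp add: abs_mult)
    qed
    ultimately have "w / 2 \<le> \<bar>x - bump_center m j\<bar>"
      by linarith
    then show ?thesis
      by (simp add: trial_eq bump_eq_0)
  qed
  have sq: "(cmod (\<Sum>k\<le>m. a k * trial m k x))\<^sup>2 = (\<Sum>k\<le>m. (cmod (a k))\<^sup>2 * (cmod (trial m k x))\<^sup>2)" for x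
  proof (cases "\<exists>k\<le>m. trial m k x \<noteq> 0")
    case True
    then obtain k where k: "k \<le> m" "trial m k x \<noteq> 0"
      by blast
    have "(\<Sum>j\<le>m. a j * trial m j x) = (\<Sum>j\<in>{k}. a j * trial m j x)"
      using k disjoint by (intro sum.mono_neutral_right) auto
    moreover have "(\<Sum>j\<le>m. (cmod (a j))\<^sup>2 * (cmod (trial m j x))\<^sup>2) = (\<Sum>j\<in>{k}. (cmod (a j))\<^sup>2 * (cmod (trial m j x))\<^sup>2)"
      using k disjoint by (intro sum.mono_neutral_right) auto
    ultimately show ?thesis
      by (simp add: norm_mult power_mult_distrib)
  qed simp
  have "(norm (abs_L2 (\<lambda>x. \<Sum>k\<le>m. a k * trial m k x)))\<^sup>2 =
      (LINT x|L_interval. (\<Sum>k\<le>m. (cmod (a k))\<^sup>2 * (cmod (trial m k x))\<^sup>2))"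
    using scale_L2_sum_abs[of "{..m}" "trial m" a] square_integrable_trial
    by (subst norm_abs_L2) (auto simp: sq)
  also have "\<dots> = (\<Sum>k\<le>m. (cmod (a k))\<^sup>2 * (w / 2))"
    by (subst Bochner_Integration.integral_sum) (auto simp: trial_square_integral intro!: sum.cong)
  finally show ?thesis
    by (simp add: sum_distrib_left mult_ac)
qed

text \<open>Only \<open>\<bar>s\<bar> \<le> A\<close> is kept in the Fourier form. There
  \<open>sech (s / c) \<ge> sech (A / c)\<close>, and \<open>A \<le> pi / w\<close> gives the bound
  \<open>w / 2\<close> for the bump. The substitution \<open>\<theta> = - w * s\<close> divides by
  \<open>w\<close>, so \<open>(w / 2)\<^sup>2\<close> becomes \<open>w / 4\<close>.\<close>

lemma inner_Q_trial_sum_ge: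
  fixes a :: "nat \<Rightarrow> complex"
  assumes c: "c > 0" and A: "0 < A" "A \<le> pi / w"
  defines "F \<equiv> abs_L2 (\<lambda>x. \<Sum>k\<le>m. a k * trial m k x)"
  shows "sech (A / c) * (w / 4) * integral {- (A * w)..A * w} (\<lambda>\<theta>. (cmod (trigpoly m a \<theta>))\<^sup>2) \<le> inner (Q c F) F"
proof -
  define f where "f = (\<lambda>x. \<Sum>k\<le>m. a k * trial m k x)"
  define g where "g = (\<lambda>\<theta>. (cmod (trigpoly m a \<theta>))\<^sup>2)"
  have f: "square_integrable f"
    using scale_L2_sum_abs[of "{..m}" "trial m" a] square_integrable_trial by (simp add: f_def)
  have gcont: "continuous_on B g" for B
    unfolding g_def by (intro continuous_intros)
  have g: "has_bochner_integral lborel (\<lambda>\<theta>. indicator {- (A * w)..A * w} \<theta> * g \<theta>) (integral {- (A * w)..A * w} g)"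
    by (rule has_bochner_integral_indicator_Icc[OF gcont])
  have ind: "indicator {- (A * w)..A * w} (0 + - w * s) = (indicator {- A..A} s :: real)" for s
  proof -
    have "- w * s \<le> A * w \<longleftrightarrow> - s \<le> A"
      using mult_le_cancel_left_pos[OF w_pos, of "- s" A] by (simp add: mult.commute)
    moreover have "- (A * w) \<le> - w * s \<longleftrightarrow> s \<le> A"
      using mult_le_cancel_left_pos[OF w_pos, of s A] by (simp add: mult.commute)
    ultimately show ?thesis
      by (simp add: indicator_def) linarith
  qed
  have int: "integrable lborel (\<lambda>s. indicator {- A..A} s * g (- w * s))"
    using lborel_integrable_real_affine[of _ "- w" 0] g w_pos
    unfolding has_bochner_integral_iff by (metis (no_types, lifting) ind add_0 less_irrefl neg_equal_0_iff_equal Bochner_Integration.integrable_cong)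
  have "integral {- (A * w)..A * w} g = w * (LINT s|lborel. indicator {- A..A} s * g (- w * s))"
  proof -
    have "integral {- (A * w)..A * w} g = (LINT \<theta>|lborel. indicator {- (A * w)..A * w} \<theta> * g \<theta>)"
      using g by (simp add: has_bochner_integral_iff)
    also have "\<dots> = \<bar>- w\<bar> *\<^sub>R (LINT s|lborel. indicator {- (A * w)..A * w} (0 + - w * s) * g (0 + - w * s))"
      using w_pos by (intro lborel_integral_real_affine) simp
    also have "\<dots> = w * (LINT s|lborel. indicator {- A..A} s * g (- w * s))"
      unfolding ind using w_pos by simp
    finally show ?thesis .
  qed
  then have "sech (A / c) * (w / 4) * integral {- (A * w)..A * w} g =
      (LINT s|lborel. sech (A / c) * (w / 2)\<^sup>2 * (indicator {- A..A} s * g (- w * s)))"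
    by (simp add: power2_eq_square)
  also have "\<dots> \<le> (LINT s|lborel. sech (s / c) * (cmod (fourier f s))\<^sup>2)"
  proof (rule integral_mono)
    show "integrable lborel (\<lambda>s. sech (A / c) * (w / 2)\<^sup>2 * (indicator {- A..A} s * g (- w * s)))"
      using int by simp
    show "integrable lborel (\<lambda>s. sech (s / c) * (cmod (fourier f s))\<^sup>2)"
      by (rule inner_Q_abs(2)[OF c f])
    fix s
    show "sech (A / c) * (w / 2)\<^sup>2 * (indicator {- A..A} s * g (- w * s)) \<le> sech (s / c) * (cmod (fourier f s))\<^sup>2"
    proof (cases "\<bar>s\<bar> \<le> A")
      case True
      have "cosh (s / c) \<le> cosh (A / c)"
        using True c A by (subst cosh_real_abs[symmetric], subst cosh_real_nonneg_le_iff) (auto simp: divide_right_mono)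
      then have 1: "sech (A / c) \<le> sech (s / c)"
        unfolding sech_def by (intro divide_left_mono) auto
      have "w / 2 \<le> cmod (bump_fourier w s)"
        using True A by (intro norm_bump_fourier_ge w_pos) auto
      then have 2: "(w / 2)\<^sup>2 \<le> (cmod (bump_fourier w s))\<^sup>2"
        using w_pos by (intro power_mono) auto
      have "(cmod (fourier f s))\<^sup>2 = (cmod (bump_fourier w s))\<^sup>2 * g (- w * s)"
        unfolding f_def fourier_trial_sum g_def by (simp add: norm_mult power_mult_distrib del: of_real_mult)
      moreover have "sech (A / c) * (w / 2)\<^sup>2 * g (- w * s) \<le> sech (s / c) * (cmod (bump_fourier w s))\<^sup>2 * g (- w * s)"
        using 1 2 sech_pos[of "s / c"] by (intro mult_right_mono mult_mono) (auto simp: g_def)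
      moreover have "s \<in> {- A..A}"
        using True by auto
      ultimately show ?thesis
        by (simp add: mult.assoc)
    next
      case False
      then have "s \<notin> {- A..A}"
        by auto
      then show ?thesis
        using sech_pos[of "s / c"] by simp
    qed
  qed
  also have "\<dots> = inner (Q c F) F"
    unfolding F_def f_def[symmetric] by (rule inner_Q_abs(1)[OF c f, symmetric])
  finally show ?thesis
    by (simp add: g_def)
qed

text \<open>
  Since the trial functions have disjoint supports, an arc inequality for trigonometric
  polynomials is a lower bound for the Rayleigh quotient on their span.
\<close>

lemma Q_eigenvalue_ge_arc:
  assumes c: "c > 0" and ev: "decreasing_eigenvalues (Q c) \<rho>"
    and A: "0 < A" "A \<le> pi / w" and "C > 0"
    and arc: "\<And>a. C * (\<Sum>k\<le>m. (cmod (a k))\<^sup>2) \<le>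
      integral {- (A * w)..A * w} (\<lambda>\<theta>. (cmod (trigpoly m a \<theta>))\<^sup>2)"
  shows "sech (A / c) * C / 2 \<le> \<rho> m"
proof (rule Q_eigenvalue_ge[OF c ev, where \<phi> = "\<lambda>k. abs_L2 (trial m k)"])
  show pos: "sech (A / c) * C / 2 > 0"
    using sech_pos[of "A / c"] \<open>C > 0\<close> by simp
  fix a F
  assume a: "\<exists>k\<le>m. a k \<noteq> 0" and F: "F = (\<Sum>k\<le>m. scale_L2 (a k) (abs_L2 (trial m k)))"
  have F': "F = abs_L2 (\<lambda>x. \<Sum>k\<le>m. a k * trial m k x)"
    unfolding F using scale_L2_sum_abs[of "{..m}" "trial m" a] square_integrable_trial by simp
  define S where "S = (\<Sum>k\<le>m. (cmod (a k))\<^sup>2)"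
  have "S > 0"
    unfolding S_def using a by (auto intro: sum_pos2)
  have nF: "(norm F)\<^sup>2 = w / 2 * S"
    unfolding F' S_def by (rule norm_trial_sum)
  have "(norm F)\<^sup>2 > 0"
    unfolding nF using \<open>S > 0\<close> w_pos by simp
  moreover have "sech (A / c) * C / 2 * (norm F)\<^sup>2 \<le> inner (Q c F) F"
  proof -
    \<comment> \<open>The squared norm carries \<open>w / 2\<close> and the form
      \<open>w / 4\<close>, so the width cancels and \<open>1 / 2\<close> remains.\<close>
    have "sech (A / c) * C / 2 * (norm F)\<^sup>2 = sech (A / c) * (w / 4) * (C * S)"
      by (simp add: nF)
    also have "\<dots> \<le> sech (A / c) * (w / 4) * integral {- (A * w)..A * w} (\<lambda>\<theta>. (cmod (trigpoly m a \<theta>))\<^sup>2)"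
      unfolding S_def using sech_pos[of "A / c"] w_pos by (intro mult_left_mono arc) auto
    also have "\<dots> \<le> inner (Q c F) F"
      unfolding F' by (rule inner_Q_trial_sum_ge[OF c A])
    finally show ?thesis .
  qed
  ultimately show "F \<noteq> 0 \<and> sech (A / c) * C / 2 * (norm F)\<^sup>2 \<le> inner (Q c F) F"
    by auto
qed

end

section \<open>Numerical estimates and the two lower bounds\<close>

lemma Suc_power_le_four_power_fact: "real (Suc m) ^ m \<le> 4 ^ m * fact m"
proof (induction m)
  case (Suc m)
  define n where "n = real (Suc m)"
  have "n > 0"
    by (simp add: n_def)
  \<comment> \<open>Here \<open>n = Suc m\<close>, so this power is the growth factor beyond
    \<open>n * n ^ m\<close> in the induction step; the bound \<open>exp 1\<close> leaves room below
    the base \<open>4\<close>.\<close>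
  have "(1 + 1 / n) ^ Suc m \<le> exp 1"
    using exp_ge_one_plus_x_over_n_power_n[of "Suc m" 1] by (simp add: n_def)
  also have "\<dots> \<le> (4::real)"
    using e_less_272 by simp
  finally have "n ^ Suc m * (1 + 1 / n) ^ Suc m \<le> n ^ Suc m * 4"
    using \<open>n > 0\<close> by (intro mult_left_mono) auto
  moreover have "n ^ Suc m * (1 + 1 / n) ^ Suc m = real (Suc (Suc m)) ^ Suc m"
    using \<open>n > 0\<close> unfolding power_mult_distrib[symmetric] by (simp add: n_def distrib_left)
  moreover have "n ^ Suc m * 4 \<le> n * (4 ^ m * fact m) * 4"
    using Suc.IH \<open>n > 0\<close> unfolding n_def power_Suc by (intro mult_right_mono mult_left_mono) auto
  ultimately have "real (Suc (Suc m)) ^ Suc m \<le> n * (4 ^ m * fact m) * 4"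
    by linarith
  also have "\<dots> = 4 ^ Suc m * fact (Suc m)"
    by (simp add: n_def)
  finally show ?case .
qed simp

lemma sech_ge_exp_minus:
  assumes "x \<ge> 0"
  shows "exp (- x) \<le> sech x"
proof -
  have "cosh x \<le> exp x"
    using assms by (simp add: cosh_field_def)
  then have "1 / exp x \<le> 1 / cosh x"
    by (intro divide_left_mono) auto
  then show ?thesis
    by (simp add: sech_def exp_minus divide_inverse)
qed

text \<open>The first bound feeds \<open>sech_Suc_ge\<close>; the second ensures that
  \<open>7 * (exp 1)\<^sup>2 * pi / 2\<close> exceeds \<open>72\<close>. The latter comes from
  \<open>exp (1 / 2) \<ge> 13 / 8\<close> raised to the fourth power.\<close>

lemma exp_1_bounds: "5 / 2 \<le> exp (1::real)" "69 / 10 \<le> (exp (1::real))\<^sup>2"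
proof -
  show "5 / 2 \<le> exp (1::real)"
    using exp_lower_Taylor_quadratic[of "1::real"] by simp
  have "(13 / 8 :: real) \<le> exp (1 / 2)"
    using exp_lower_Taylor_quadratic[of "1 / 2 :: real"] by (simp add: power2_eq_square)
  then have "(13 / 8 :: real) ^ 4 \<le> exp (1 / 2) ^ 4"
    by (intro power_mono) auto
  also have "exp (1 / 2 :: real) ^ 4 = (exp 1)\<^sup>2"
    by (simp flip: exp_of_nat_mult)
  finally show "69 / 10 \<le> (exp (1::real))\<^sup>2"
    by (simp add: power4_eq_xxxx)
qed

text \<open>\<open>cosh (m + 1) \<le> exp m * cosh 1\<close>, and
  \<open>cosh 1 \<le> (exp 1)\<^sup>2 / 4\<close>. The constant supplies the
  \<open>(exp 1)\<^sup>2\<close> of the final prefactor. At \<open>m = 0\<close> no power can absorb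
  a loss, and there \<open>exp (- 1)\<close>, being smaller than \<open>4 / (exp 1)\<^sup>2\<close>,
  would be too weak.\<close>

lemma sech_Suc_ge: "4 / (exp 1)\<^sup>2 * exp (- real m) \<le> sech (real (Suc m))"
proof -
  have "cosh (real (Suc m)) = (exp (real m) * exp 1 + exp (- real m) * exp (- 1)) / 2"
    by (simp add: cosh_field_def algebra_simps flip: exp_add)
  also have "\<dots> \<le> (exp (real m) * exp 1 + exp (real m) * exp (- 1)) / 2"
    by (intro divide_right_mono add_left_mono mult_right_mono) auto
  also have "\<dots> = exp (real m) * ((exp 1 + exp (- 1)) / 2)"
    by (simp add: distrib_left)
  also have "\<dots> \<le> exp (real m) * ((exp 1)\<^sup>2 / 4)"
  proof (intro mult_left_mono)
    define e where "e = exp (1::real)"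
    have "5 / 2 \<le> e"
      unfolding e_def by (rule exp_1_bounds)
    then have "1 / e \<le> 2 / 5" "5 / 2 * e \<le> e * e"
      by (auto simp: divide_le_eq intro: mult_right_mono)
    moreover have "(e + u) / 2 \<le> v / 4" if "u \<le> 2 / 5" "5 / 2 * e \<le> v" for u v
      using that \<open>5 / 2 \<le> e\<close> by (simp add: field_simps)
    ultimately have "(e + 1 / e) / 2 \<le> e\<^sup>2 / 4"
      unfolding power2_eq_square by blast
    then show "(exp 1 + exp (- 1 :: real)) / 2 \<le> (exp 1)\<^sup>2 / 4"
      unfolding e_def by (simp only: exp_minus inverse_eq_divide)
  qed simp
  finally have "1 / (exp (real m) * ((exp 1)\<^sup>2 / 4)) \<le> 1 / cosh (real (Suc m))"
    by (intro divide_left_mono) auto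
  moreover have "4 / (exp 1)\<^sup>2 * exp (- real m) = 1 / (exp (real m) * ((exp 1)\<^sup>2 / 4))"
    by (simp add: exp_minus inverse_eq_divide)
  ultimately show ?thesis
    by (simp only: sech_def)
qed

text \<open>With \<open>A = pi / w\<close> the arc is the full period, and Parseval's identity
  supplies \<open>C = 2 * pi\<close>.\<close>

lemma Q_eigenvalue_ge_sech:
  assumes "c > 0" "decreasing_eigenvalues (Q c) \<rho>"
  shows "pi * sech (pi * (real m + 1) / (2 * c)) \<le> \<rho> m"
proof -
  define A where "A = pi / (2 / real (Suc m))"
  have "sech (A / c) * (2 * pi) / 2 \<le> \<rho> m"
  proof (rule Q_eigenvalue_ge_arc[OF assms])
    show "0 < A" "A \<le> pi / (2 / real (Suc m))"
      by (simp_all add: A_def)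
    have "A * (2 / real (Suc m)) = pi"
      by (simp add: A_def)
    then show "2 * pi * (\<Sum>k\<le>m. (cmod (a k))\<^sup>2) \<le> integral {- (A * (2 / real (Suc m)))..A * (2 / real (Suc m))}
        (\<lambda>\<theta>. (cmod (trigpoly m a \<theta>))\<^sup>2)" for a
      using trigpoly_parseval[of m a] by (simp only: integral_unique)
  qed simp
  then show ?thesis
    by (simp add: A_def mult.commute add.commute divide_divide_eq_left)
qed

text \<open>With \<open>A = c * (m + 1)\<close> the arc is
  \<open>\<bar>\<theta>\<bar> \<le> 2 * c\<close>, cut into \<open>m + 1\<close> steps of length
  \<open>d\<close>; \<open>c \<le> pi / 4\<close> keeps the nodes within \<open>4\<close>. Per index
  the squared Remez constant costs \<open>(c / 12)\<^sup>2\<close>, the weight \<open>1 / 3\<close>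
  and the factor \<open>1 / n\<close> of \<open>d\<close> another \<open>1 / 12\<close>, and
  \<open>72 = 12 * 6\<close> with \<open>6\<^sup>2 = 3 * 12\<close>.\<close>

lemma Q_eigenvalue_ge_power:
  assumes "0 < c" "c \<le> pi / 4" "decreasing_eigenvalues (Q c) \<rho>"
  shows "8 * c / (exp 1)\<^sup>2 * ((c / 72) ^ m)\<^sup>2 \<le> \<rho> m"
proof -
  define n where "n = real (Suc m)"
  define d where "d = 4 * c / n"
  define A where "A = c * n"
  have n: "n \<ge> 1" "n > 0" "real m \<le> n"
    by (simp_all add: n_def)
  have d: "d > 0" "real m * d \<le> 4"
  proof -
    show "d > 0"
      using assms(1) n by (simp add: d_def)
    have "real m * d \<le> n * d"
      using \<open>d > 0\<close> n by (intro mult_right_mono) auto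
    also have "\<dots> = 4 * c"
      using n by (simp add: d_def)
    also have "\<dots> \<le> 4"
      using assms(2) pi_less_4 by simp
    finally show "real m * d \<le> 4" .
  qed
  have "sech (A / c) * (d * (fact m * (d / 12) ^ m)\<^sup>2) / 2 \<le> \<rho> m"
  proof (rule Q_eigenvalue_ge_arc[OF assms(1,3)])
    show "0 < A"
      using assms(1) n by (simp add: A_def)
    have "c \<le> pi / 2"
      using assms(2) pi_gt_zero by linarith
    then have "c * n \<le> pi / 2 * n"
      using n by (intro mult_right_mono) auto
    then show "A \<le> pi / (2 / real (Suc m))"
      by (simp add: A_def n_def)
    show "0 < d * (fact m * (d / 12) ^ m)\<^sup>2"
      using d(1) by simp
    have "A * (2 / real (Suc m)) = 2 * c"
      by (simp add: A_def n_def del: of_nat_Suc)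
    moreover have "- (2 * c) + real (Suc m) * d = 2 * c"
      by (simp add: d_def n_def del: of_nat_Suc)
    ultimately show "d * (fact m * (d / 12) ^ m)\<^sup>2 * (\<Sum>k\<le>m. (cmod (a k))\<^sup>2) \<le>
        integral {- (A * (2 / real (Suc m)))..A * (2 / real (Suc m))} (\<lambda>\<theta>. (cmod (trigpoly m a \<theta>))\<^sup>2)" for a
      using trigpoly_remez[OF d, of a "- (2 * c)"] by simp
  qed
  moreover have "8 * c / (exp 1)\<^sup>2 * ((c / 72) ^ m)\<^sup>2 \<le> sech (A / c) * (d * (fact m * (d / 12) ^ m)\<^sup>2) / 2"
  proof -
    \<comment> \<open>Since \<open>d / 12 = (c / 3) / n\<close>, the factorial has to offset
      \<open>n ^ m\<close>, which it does up to \<open>4 ^ m\<close>.\<close>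
    have 1: "1 / 4 ^ m * (c / 3) ^ m \<le> fact m * (d / 12) ^ m"
    proof -
      have "(d / 12) ^ m = (c / 3) ^ m / n ^ m"
        by (simp add: d_def flip: power_divide)
      moreover have "1 / 4 ^ m \<le> fact m / n ^ m"
        using Suc_power_le_four_power_fact[of m] n unfolding n_def[symmetric] by (simp add: field_simps)
      then have "1 / 4 ^ m * (c / 3) ^ m \<le> fact m / n ^ m * (c / 3) ^ m"
        using assms(1) by (intro mult_right_mono) auto
      ultimately show ?thesis
        by simp
    qed
    have "exp (- real m) \<ge> 1 / 3 ^ m"
    proof -
      have "exp (real m) = exp 1 ^ m"
        by (simp flip: exp_of_nat_mult)
      also have "\<dots> \<le> 3 ^ m"
        using e_less_272 by (intro power_mono) auto
      finally show ?thesis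
        by (simp add: exp_minus divide_inverse)
    qed
    \<comment> \<open>Already \<open>2 ^ m\<close> bounds \<open>n\<close>; the base
      \<open>12\<close> is taken so that its product with \<open>3\<close> is a square.\<close>
    moreover have "n \<le> 12 ^ m"
    proof -
      have "n \<le> 2 ^ m"
        unfolding n_def using less_exp[of m] by (metis Suc_leI of_nat_le_iff of_nat_numeral of_nat_power)
      also have "\<dots> \<le> (12::real) ^ m"
        by (intro power_mono) auto
      finally show ?thesis .
    qed
    then have "1 / 12 ^ m \<le> 1 / n"
      using n by (intro divide_left_mono) auto
    ultimately have 2: "1 / 3 ^ m * (1 / 12 ^ m) \<le> exp (- real m) * (1 / n)"
      by (intro mult_mono) auto
    have "8 * c / (exp 1)\<^sup>2 * ((c / 72) ^ m)\<^sup>2 =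
        8 * c / (exp 1)\<^sup>2 * (1 / 3 ^ m * (1 / 12 ^ m)) * (1 / 4 ^ m * (c / 3) ^ m)\<^sup>2"
    proof -
      have "((c / 72) ^ m)\<^sup>2 = ((c / 72) * (c / 72)) ^ m"
        by (simp only: power2_eq_square power_mult_distrib)
      also have "\<dots> = (1 / 3 * (1 / 12) * ((1 / 4 * (c / 3)) * (1 / 4 * (c / 3)))) ^ m"
        by simp
      also have "\<dots> = 1 / 3 ^ m * (1 / 12 ^ m) * (1 / 4 ^ m * (c / 3) ^ m)\<^sup>2"
        by (simp only: power2_eq_square power_mult_distrib power_one_over)
      finally show ?thesis
        by (simp only: mult.assoc)
    qed
    also have "\<dots> \<le> 8 * c / (exp 1)\<^sup>2 * (exp (- real m) * (1 / n)) * (fact m * (d / 12) ^ m)\<^sup>2"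
    proof (rule mult_mono)
      show "8 * c / (exp 1)\<^sup>2 * (1 / 3 ^ m * (1 / 12 ^ m)) \<le> 8 * c / (exp 1)\<^sup>2 * (exp (- real m) * (1 / n))"
        using assms(1) by (intro mult_left_mono 2) simp
      show "(1 / 4 ^ m * (c / 3) ^ m)\<^sup>2 \<le> (fact m * (d / 12) ^ m)\<^sup>2"
        using assms(1) by (intro power_mono 1) simp
    qed (use assms(1) n in simp_all)
    also have "\<dots> = 4 / (exp 1)\<^sup>2 * exp (- real m) * (d * (fact m * (d / 12) ^ m)\<^sup>2) / 2"
      by (simp add: d_def mult_ac)
    also have "\<dots> \<le> sech (real (Suc m)) * (d * (fact m * (d / 12) ^ m)\<^sup>2) / 2"
      using d(1) by (intro divide_right_mono mult_right_mono sech_Suc_ge) auto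
    also have "real (Suc m) = A / c"
      using assms(1) by (simp add: A_def n_def)
    finally show ?thesis .
  qed
  ultimately show ?thesis
    by linarith
qed

theorem theorem4:
  fixes c :: real and \<rho> :: "nat \<Rightarrow> real" and m :: nat
  assumes "c > 0"
    and "decreasing_eigenvalues (Q c) \<rho>"
  shows "(c \<le> pi / 4 \<longrightarrow>
           \<rho> m \<ge> 2 * (sin (2 * c))\<^sup>2 / ((exp 1)\<^sup>2 * c) *
                 exp (- 2 * ln (7 * (exp 1)\<^sup>2 * pi / (2 * c)) * real m)) \<and>
         \<rho> m \<ge> pi * exp (- (pi * (real m + 1)) / (2 * c))"
proof (intro conjI impI)
  show "pi * exp (- (pi * (real m + 1)) / (2 * c)) \<le> \<rho> m"
  proof -
    have "exp (- (pi * (real m + 1) / (2 * c))) \<le> sech (pi * (real m + 1) / (2 * c))"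
      using assms(1) by (intro sech_ge_exp_minus) simp
    then have "pi * exp (- (pi * (real m + 1) / (2 * c))) \<le> pi * sech (pi * (real m + 1) / (2 * c))"
      by (intro mult_left_mono) auto
    also have "\<dots> \<le> \<rho> m"
      by (rule Q_eigenvalue_ge_sech[OF assms])
    finally show ?thesis
      by (simp only: minus_divide_left)
  qed
  assume "c \<le> pi / 4"
  define y where "y = 7 * (exp 1)\<^sup>2 * pi / (2 * c)"
  \<comment> \<open>Numerically \<open>7 * 6.9 * 3 = 144.9\<close>, just above
    \<open>2 * 72\<close>.\<close>
  have y: "72 / c \<le> y"
  proof -
    have "7 * (69 / 10) * 3 \<le> 7 * (exp 1)\<^sup>2 * pi"
      using exp_1_bounds(2) pi_gt3 by (intro mult_mono) auto
    then show ?thesis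
      using assms(1) by (simp add: y_def field_simps)
  qed
  then have "y > 0"
    using assms(1) by (smt (verit) divide_pos_pos)
  have "exp (- 2 * ln y * real m) = (exp (- ln y) ^ m)\<^sup>2"
    by (simp flip: exp_of_nat_mult add: power2_eq_square exp_add[symmetric])
  also have "exp (- ln y) = 1 / y"
    using \<open>y > 0\<close> by (simp add: exp_minus divide_inverse)
  also have "((1 / y) ^ m)\<^sup>2 \<le> ((c / 72) ^ m)\<^sup>2"
    using y \<open>y > 0\<close> assms(1) by (intro power_mono) (auto simp: field_simps)
  finally have 1: "exp (- 2 * ln y * real m) \<le> ((c / 72) ^ m)\<^sup>2" .
  \<comment> \<open>The sine enters only through \<open>\<bar>sin (2 * c)\<bar> \<le> 2 * c\<close>,
    which turns the stated prefactor into the one of \<open>Q_eigenvalue_ge_power\<close>.\<close>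
  have 2: "2 * (sin (2 * c))\<^sup>2 / ((exp 1)\<^sup>2 * c) \<le> 8 * c / (exp 1)\<^sup>2"
  proof -
    have "(sin (2 * c))\<^sup>2 \<le> (2 * c)\<^sup>2"
      unfolding abs_le_square_iff[symmetric] using abs_sin_x_le_abs_x[of "2 * c"] by simp
    then have "2 * (sin (2 * c))\<^sup>2 / ((exp 1)\<^sup>2 * c) \<le> 2 * (2 * c)\<^sup>2 / ((exp 1)\<^sup>2 * c)"
      using assms(1) by (intro divide_right_mono) auto
    also have "\<dots> = 8 * c / (exp 1)\<^sup>2"
      using assms(1) by (simp add: power2_eq_square)
    finally show ?thesis .
  qed
  have "2 * (sin (2 * c))\<^sup>2 / ((exp 1)\<^sup>2 * c) * exp (- 2 * ln y * real m) \<le> 8 * c / (exp 1)\<^sup>2 * ((c / 72) ^ m)\<^sup>2"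
    using 1 2 assms(1) by (intro mult_mono) auto
  also have "\<dots> \<le> \<rho> m"
    by (rule Q_eigenvalue_ge_power) fact+
  finally show "2 * (sin (2 * c))\<^sup>2 / ((exp 1)\<^sup>2 * c) * exp (- 2 * ln (7 * (exp 1)\<^sup>2 * pi / (2 * c)) * real m) \<le> \<rho> m"
    unfolding y_def .
qed

end
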